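(* If $G$ is a finite group whose order is a product of distinct primes, then the group algebra $\mathbb{C}[G]$ is of Knutson type.
   Context: For a finite group $G$, a virtual $\mathbb{C}[G]$-module is an integer linear combination of simple $\mathbb{C}[G]$-modules (an element of the representation ring). The Knutson Index $\mathcal{K}(M)$ of a $\mathbb{C}[G]$-module $M$ is the smallest integer $n\ge1$ such that $M\otimes N\cong n\,\mathbb{C}[G]$ (equality in the representation ring) for some virtual $\mathbb{C}[G]$-module $N$. The group algebra $\mathbb{C}[G]$ is of Knutson type if $\mathcal{K}(M)=1$ for every simple $\mathbb{C}[G]$-module $M$. *)

theory Defs
  imports
    "HOL-Algebra.Coset"
    "HOL-Computational_Algebra.Primes"
    "Jordan_Normal_Form.Matrix"
begin

text \<open>
  A finite-dimensional \<open>\<complex>[G]\<close>-module is given by its dimension \<open>n\<close> together with the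
  matrices by which the elements of \<open>G\<close> act on the column space \<open>\<complex>\<^sup>n\<close>. The values of
  the action outside \<open>carrier G\<close> are irrelevant. Dimension \<open>0\<close> (the zero module) is
  allowed.
\<close>

record 'g cmod =
  vdim :: nat
  act :: "'g \<Rightarrow> complex mat"

definition cg_module :: "('g, 'b) monoid_scheme \<Rightarrow> 'g cmod \<Rightarrow> bool" where
  "cg_module G M \<longleftrightarrow>
     (\<forall>g\<in>carrier G. act M g \<in> carrier_mat (vdim M) (vdim M)) \<and>
     act M \<one>\<^bsub>G\<^esub> = 1\<^sub>m (vdim M) \<and>
     (\<forall>g\<in>carrier G. \<forall>h\<in>carrier G. act M (g \<otimes>\<^bsub>G\<^esub> h) = act M g * act M h)"

definition cg_iso :: "('g, 'b) monoid_scheme \<Rightarrow> 'g cmod \<Rightarrow> 'g cmod \<Rightarrow> bool" where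
  "cg_iso G M N \<longleftrightarrow> vdim M = vdim N \<and>
     (\<exists>P \<in> carrier_mat (vdim M) (vdim M). invertible_mat P \<and>
        (\<forall>g\<in>carrier G. P * act M g = act N g * P))"

definition cg_submodule :: "('g, 'b) monoid_scheme \<Rightarrow> 'g cmod \<Rightarrow> complex vec set \<Rightarrow> bool" where
  "cg_submodule G M W \<longleftrightarrow>
     W \<subseteq> carrier_vec (vdim M) \<and> 0\<^sub>v (vdim M) \<in> W \<and>
     (\<forall>v\<in>W. \<forall>w\<in>W. v + w \<in> W) \<and>
     (\<forall>c. \<forall>v\<in>W. c \<cdot>\<^sub>v v \<in> W) \<and>
     (\<forall>g\<in>carrier G. \<forall>v\<in>W. act M g *\<^sub>v v \<in> W)"

definition simple_cg_module :: "('g, 'b) monoid_scheme \<Rightarrow> 'g cmod \<Rightarrow> bool" where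
  "simple_cg_module G M \<longleftrightarrow> cg_module G M \<and> vdim M \<noteq> 0 \<and>
     (\<forall>W. cg_submodule G M W \<longrightarrow> W = {0\<^sub>v (vdim M)} \<or> W = carrier_vec (vdim M))"

definition cg_direct_sum :: "'g cmod list \<Rightarrow> 'g cmod" where
  "cg_direct_sum Ms =
     \<lparr>vdim = sum_list (map vdim Ms), act = (\<lambda>g. diag_block_mat (map (\<lambda>M. act M g) Ms))\<rparr>"

text \<open>
  The tensor product over \<open>\<complex>\<close> with the diagonal action, in the basis
  \<open>e\<^sub>i \<otimes> f\<^sub>j\<close> ordered lexicographically, so the matrices are Kronecker products.
\<close>

definition kronecker_product :: "complex mat \<Rightarrow> complex mat \<Rightarrow> complex mat" where
  "kronecker_product A B =
     mat (dim_row A * dim_row B) (dim_col A * dim_col B)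
       (\<lambda>(i, j). A $$ (i div dim_row B, j div dim_col B) * B $$ (i mod dim_row B, j mod dim_col B))"

definition cg_tensor :: "'g cmod \<Rightarrow> 'g cmod \<Rightarrow> 'g cmod" where
  "cg_tensor M N =
     \<lparr>vdim = vdim M * vdim N, act = (\<lambda>g. kronecker_product (act M g) (act N g))\<rparr>"

text \<open>
  The module \<open>\<complex>[G]\<close> itself: the basis is \<open>G\<close>, listed in an arbitrary order, and \<open>g\<close>
  acts by left multiplication. The choice of the order only affects the module up to
  isomorphism.
\<close>

definition group_enum :: "('g, 'b) monoid_scheme \<Rightarrow> nat \<Rightarrow> 'g" where
  "group_enum G = (SOME f. bij_betw f {..<order G} (carrier G))"

definition regular_cg_module :: "('g, 'b) monoid_scheme \<Rightarrow> 'g cmod" where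
  "regular_cg_module G =
     \<lparr>vdim = order G,
      act = (\<lambda>g. mat (order G) (order G)
        (\<lambda>(i, j). if group_enum G i = g \<otimes>\<^bsub>G\<^esub> group_enum G j then 1 else 0))\<rparr>"

text \<open>
  An integer combination \<open>a\<^sub>1 [M\<^sub>1] + \<dots> + a\<^sub>k [M\<^sub>k]\<close> of modules is written as the list of
  pairs \<open>(a\<^sub>i, M\<^sub>i)\<close>. The positive (negative) part is the direct sum of \<open>\<bar>a\<^sub>i\<bar>\<close> copies of
  \<open>M\<^sub>i\<close> over those \<open>i\<close> with \<open>a\<^sub>i > 0\<close> (\<open>a\<^sub>i < 0\<close>); recall that \<open>nat\<close> sends negative
  integers to \<open>0\<close>.
\<close>

definition pos_part :: "(int \<times> 'g cmod) list \<Rightarrow> 'g cmod" where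
  "pos_part X = cg_direct_sum (concat (map (\<lambda>(a, M). replicate (nat a) M) X))"

definition neg_part :: "(int \<times> 'g cmod) list \<Rightarrow> 'g cmod" where
  "neg_part X = cg_direct_sum (concat (map (\<lambda>(a, M). replicate (nat (- a)) M) X))"

text \<open>
  Equality of two combinations in the representation ring, i.e. in the Grothendieck group
  of the monoid of isomorphism classes of modules under direct sum:
  \<open>[X\<^sup>+] - [X\<^sup>-] = [Y\<^sup>+] - [Y\<^sup>-]\<close> iff \<open>X\<^sup>+ \<oplus> Y\<^sup>- \<oplus> E\<close> and \<open>Y\<^sup>+ \<oplus> X\<^sup>- \<oplus> E\<close> are
  isomorphic for some module \<open>E\<close>.
\<close>

definition rep_ring_eq ::
  "('g, 'b) monoid_scheme \<Rightarrow> (int \<times> 'g cmod) list \<Rightarrow> (int \<times> 'g cmod) list \<Rightarrow> bool" where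
  "rep_ring_eq G X Y \<longleftrightarrow>
     (\<exists>E. cg_module G E \<and>
        cg_iso G (cg_direct_sum [pos_part X, neg_part Y, E])
                 (cg_direct_sum [pos_part Y, neg_part X, E]))"

definition virtual_module :: "('g, 'b) monoid_scheme \<Rightarrow> (int \<times> 'g cmod) list \<Rightarrow> bool" where
  "virtual_module G N \<longleftrightarrow> (\<forall>(a, S)\<in>set N. simple_cg_module G S)"

definition virtual_tensor :: "'g cmod \<Rightarrow> (int \<times> 'g cmod) list \<Rightarrow> (int \<times> 'g cmod) list" where
  "virtual_tensor M N = map (\<lambda>(a, S). (a, cg_tensor M S)) N"

text \<open>
  For finite \<open>G\<close> and nonzero \<open>M\<close> the set of admissible \<open>n\<close> is nonempty, since
  \<open>M \<otimes> \<complex>[G]\<close> is isomorphic to \<open>dim M\<close> copies of \<open>\<complex>[G]\<close>; for the zero module it is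
  empty and the value is meaningless.
\<close>

definition knutson_index :: "('g, 'b) monoid_scheme \<Rightarrow> 'g cmod \<Rightarrow> nat" where
  "knutson_index G M =
     (LEAST n. n \<ge> 1 \<and>
        (\<exists>N. virtual_module G N \<and>
           rep_ring_eq G (virtual_tensor M N) [(int n, regular_cg_module G)]))"

definition group_algebra_of_knutson_type :: "('g, 'b) monoid_scheme \<Rightarrow> bool" where
  "group_algebra_of_knutson_type G \<longleftrightarrow>
     (\<forall>M. simple_cg_module G M \<longrightarrow> knutson_index G M = 1)"

end

theory Submission
  imports Defs "Jordan_Normal_Form.Schur_Decomposition" "Jordan_Normal_Form.Spectral_Radius"
    "HOL-Algebra.Multiplicative_Group" "HOL-Algebra.Sylow" "HOL-Computational_Algebra.Squarefree"
begin

text \<open>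
  Let \<open>M\<close> be a simple module of dimension \<open>d\<close> with character \<open>\<chi>\<close>, and suppose that \<open>\<chi>\<close> vanishes on a
  subgroup \<open>H\<close> except at the identity. The character of \<open>\<complex>[G/H]\<close> vanishes off the conjugates of \<open>H\<close>,
  so the character of \<open>M \<otimes> \<complex>[G/H]\<close> is concentrated at the identity, and therefore
  \<open>M \<otimes> \<complex>[G/H] \<cong> (d / |H|) \<complex>[G]\<close>. The trivial subgroup gives the multiple \<open>d\<close>. If \<open>p\<close> is a prime
  divisor of \<open>d\<close> and \<open>|G|\<close> is squarefree, then a Sylow \<open>p\<close>-subgroup has order \<open>p\<close> and gives the multiple
  \<open>d / p\<close>, provided that \<open>\<chi>\<close> vanishes on the elements of order \<open>p\<close>. As \<open>d\<close> divides \<open>|G|\<close>, it is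
  squarefree as well; hence the numbers \<open>d\<close> and \<open>d / p\<close> have greatest common divisor \<open>1\<close>, and an
  integer combination of the modules \<open>\<complex>[G/H]\<close> is a virtual module \<open>N\<close> with \<open>M \<otimes> N = \<complex>[G]\<close>
  (\<open>regular_multiple_coset\<close>, \<open>regular_multiple_one\<close>).

  Both facts about \<open>\<chi>\<close>, that \<open>d\<close> divides \<open>|G|\<close> (\<open>degree_dvd_order\<close>) and that \<open>\<chi>\<close> vanishes on elements of
  order \<open>p\<close> (\<open>character_vanishes_on_order_p\<close>, an instance of the vanishing of characters of
  \<open>p\<close>-defect zero), come from the formula
  \<open>\<Sum> \<chi>(g\<^sub>1) \<dots> \<chi>(g\<^sub>L) = (|G| / d)\<^sup>L\<^sup>-\<^sup>1 \<chi>(y)\<close>, where the sum extends over all tuples with product \<open>y\<close>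
  (\<open>character_iterated_convolution\<close>). Its left side is an integer combination of roots of unity for
  every \<open>L\<close>, which bounds the denominator of \<open>|G| / d\<close>. When \<open>y\<close> runs over the class of an element of
  order \<open>p\<close> and \<open>L = p\<^sup>k\<close>, cyclic rotation acts freely on the tuples, so the sum is divisible by \<open>p\<^sup>k\<close>,
  while \<open>|G| / d\<close> is prime to \<open>p\<close>. In both cases the conclusion is that a nonzero element of a finitely
  generated subgroup of \<open>\<complex>\<close> is not divisible by arbitrarily high powers of an integer greater than \<open>1\<close>
  (\<open>int_span_infinitely_divisible\<close>).

  Working with characters is legitimate because modules with equal characters are isomorphic
  (\<open>equal_characters_iso\<close>), and because every character is a sum of characters of simple modules
  (\<open>character_sum_of_simple\<close>). Both are proved by splitting off the image of an equivariant idempotent,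
  which exists by Maschke's averaging argument (\<open>hom_generalized_inverse\<close>).
\<close>

text \<open>Below, \<open>order\<close> is the order of a group, as opposed to the order of a root of a polynomial.\<close>

hide_const (open) Polynomial.order

section \<open>Traces and sums of matrices\<close>

definition mat_trace :: "'a::comm_monoid_add mat \<Rightarrow> 'a" where
  "mat_trace A = (\<Sum>i<dim_row A. A $$ (i, i))"

lemma index_mult_mat_sum:
  assumes "A \<in> carrier_mat n m" "B \<in> carrier_mat m k" "i < n" "j < k"
  shows "(A * B) $$ (i, j) = (\<Sum>l<m. A $$ (i, l) * B $$ (l, j))"
  using assms by (auto simp: scalar_prod_def atLeast0LessThan intro!: sum.cong)

lemma mult_mat_assoc_dim:
  fixes A B C :: "'a::semiring_0 mat"
  assumes "dim_col A = dim_row B" "dim_col B = dim_row C"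
  shows "A * B * C = A * (B * C)"
proof (rule assoc_mult_mat)
  show "A \<in> carrier_mat (dim_row A) (dim_row B)" by (rule carrier_matI[OF refl assms(1)])
  show "B \<in> carrier_mat (dim_row B) (dim_row C)" by (rule carrier_matI[OF refl assms(2)])
  show "C \<in> carrier_mat (dim_row C) (dim_col C)" by (rule carrier_matI[OF refl refl])
qed

lemma cancel_inverse_mat:
  fixes R K X :: "'a::semiring_1 mat"
  assumes RK: "R * K = 1\<^sub>m r" and "R \<in> carrier_mat r m" "K \<in> carrier_mat m r" "dim_row X = r"
  shows "R * (K * X) = X"
proof -
  have "R * (K * X) = R * K * X"
    by (rule mult_mat_assoc_dim[symmetric]) (use assms(2-) in auto)
  also have "\<dots> = X" unfolding RK by (rule left_mult_one_mat) (use assms(4) in auto)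
  finally show ?thesis .
qed

lemma mat_trace_mult_comm:
  fixes A B :: "'a::comm_semiring_0 mat"
  assumes "A \<in> carrier_mat n m" "B \<in> carrier_mat m n"
  shows "mat_trace (A * B) = mat_trace (B * A)"
proof -
  have "mat_trace (A * B) = (\<Sum>i<n. \<Sum>l<m. A $$ (i, l) * B $$ (l, i))"
    unfolding mat_trace_def using assms
    by (intro sum.cong) (auto simp: index_mult_mat_sum[OF assms] simp del: index_mult_mat(1))
  also have "\<dots> = (\<Sum>l<m. \<Sum>i<n. B $$ (l, i) * A $$ (i, l))"
    by (subst sum.swap) (simp add: mult.commute)
  also have "\<dots> = mat_trace (B * A)"
    unfolding mat_trace_def using assms
    by (intro sum.cong) (auto simp: index_mult_mat_sum[OF assms(2,1)] simp del: index_mult_mat(1))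
  finally show ?thesis .
qed

lemma mat_trace_minus:
  fixes A B :: "'a::ab_group_add mat"
  assumes "A \<in> carrier_mat n n" "B \<in> carrier_mat n n"
  shows "mat_trace (A - B) = mat_trace A - mat_trace B"
  using assms by (auto simp: mat_trace_def sum_subtractf[symmetric] intro!: sum.cong)

lemma mat_trace_smult:
  fixes A :: "'a::semiring_0 mat"
  assumes "A \<in> carrier_mat n n"
  shows "mat_trace (c \<cdot>\<^sub>m A) = c * mat_trace A"
  using assms by (auto simp: mat_trace_def sum_distrib_left intro!: sum.cong)

lemma mat_trace_one: "mat_trace (1\<^sub>m n :: 'a::semiring_1 mat) = of_nat n"
  by (simp add: mat_trace_def)

lemma mat_trace_four_block:
  assumes "A \<in> carrier_mat n n" "D \<in> carrier_mat m m"
  shows "mat_trace (four_block_mat A B C D) = mat_trace A + mat_trace D"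
proof -
  have "mat_trace (four_block_mat A B C D) =
      (\<Sum>i\<in>{..<n} \<union> {n..<n + m}. if i < n then A $$ (i, i) else D $$ (i - n, i - n))"
    using assms by (auto simp: mat_trace_def intro!: sum.cong)
  also have "\<dots> = (\<Sum>i<n. A $$ (i, i)) + (\<Sum>i=n..<n + m. D $$ (i - n, i - n))"
    by (subst sum.union_disjoint) (auto intro!: arg_cong2[where f = "(+)"] sum.cong)
  also have "(\<Sum>i=n..<n + m. D $$ (i - n, i - n)) = (\<Sum>i<m. D $$ (i, i))"
    using sum.shift_bounds_nat_ivl[of "\<lambda>i. D $$ (i - n, i - n)" 0 n m]
    by (simp add: atLeast0LessThan add.commute)
  finally show ?thesis using assms by (simp add: mat_trace_def)
qed

definition mat_sum :: "nat \<Rightarrow> nat \<Rightarrow> ('i \<Rightarrow> 'a::comm_monoid_add mat) \<Rightarrow> 'i set \<Rightarrow> 'a mat" where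
  "mat_sum n m F S = mat n m (\<lambda>(i, j). \<Sum>s\<in>S. F s $$ (i, j))"

lemma mat_sum_carrier [simp]: "mat_sum n m F S \<in> carrier_mat n m"
  by (simp add: mat_sum_def)

lemma mat_sum_cong:
  assumes "\<And>s. s \<in> S \<Longrightarrow> F s = H s"
  shows "mat_sum n m F S = mat_sum n m H S"
  unfolding mat_sum_def using assms by (intro cong_mat) auto

lemma mat_sum_reindex:
  assumes "bij_betw f S T"
  shows "mat_sum n m F T = mat_sum n m (\<lambda>s. F (f s)) S"
  unfolding mat_sum_def by (intro cong_mat) (auto simp: sum.reindex_bij_betw[OF assms, symmetric])

lemma mult_mat_sum:
  fixes A :: "'a::semiring_0 mat"
  assumes "A \<in> carrier_mat k n" "\<And>s. s \<in> S \<Longrightarrow> F s \<in> carrier_mat n m"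
  shows "A * mat_sum n m F S = mat_sum k m (\<lambda>s. A * F s) S"
proof (rule eq_matI)
  fix i j assume "i < dim_row (mat_sum k m (\<lambda>s. A * F s) S)" "j < dim_col (mat_sum k m (\<lambda>s. A * F s) S)"
  hence ij: "i < k" "j < m" by (auto simp: mat_sum_def)
  have "(A * mat_sum n m F S) $$ (i, j) = (\<Sum>l<n. \<Sum>s\<in>S. A $$ (i, l) * F s $$ (l, j))"
    using ij assms(1) by (subst index_mult_mat_sum[OF assms(1) mat_sum_carrier])
      (auto simp: mat_sum_def sum_distrib_left intro!: sum.cong)
  also have "\<dots> = (\<Sum>s\<in>S. (A * F s) $$ (i, j))"
    using assms ij by (subst sum.swap, intro sum.cong) (auto simp: index_mult_mat_sum[OF assms(1) assms(2)] simp del: index_mult_mat(1))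
  finally show "(A * mat_sum n m F S) $$ (i, j) = mat_sum k m (\<lambda>s. A * F s) S $$ (i, j)"
    using ij by (simp add: mat_sum_def)
qed (use assms in \<open>auto simp: mat_sum_def\<close>)

lemma mat_sum_mult:
  fixes A :: "'a::semiring_0 mat"
  assumes "A \<in> carrier_mat m k" "\<And>s. s \<in> S \<Longrightarrow> F s \<in> carrier_mat n m"
  shows "mat_sum n m F S * A = mat_sum n k (\<lambda>s. F s * A) S"
proof (rule eq_matI)
  fix i j assume "i < dim_row (mat_sum n k (\<lambda>s. F s * A) S)" "j < dim_col (mat_sum n k (\<lambda>s. F s * A) S)"
  hence ij: "i < n" "j < k" by (auto simp: mat_sum_def)
  have "(mat_sum n m F S * A) $$ (i, j) = (\<Sum>l<m. \<Sum>s\<in>S. F s $$ (i, l) * A $$ (l, j))"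
    using ij assms(1) by (subst index_mult_mat_sum[OF mat_sum_carrier assms(1)])
      (auto simp: mat_sum_def sum_distrib_right intro!: sum.cong)
  also have "\<dots> = (\<Sum>s\<in>S. (F s * A) $$ (i, j))"
    using assms ij by (subst sum.swap, intro sum.cong) (auto simp: index_mult_mat_sum[OF assms(2) assms(1)] simp del: index_mult_mat(1))
  finally show "(mat_sum n m F S * A) $$ (i, j) = mat_sum n k (\<lambda>s. F s * A) S $$ (i, j)"
    using ij by (simp add: mat_sum_def)
qed (use assms in \<open>auto simp: mat_sum_def\<close>)

lemma mat_sum_const:
  fixes A :: "'a::comm_semiring_1 mat"
  assumes "A \<in> carrier_mat n m"
  shows "mat_sum n m (\<lambda>_. A) S = of_nat (card S) \<cdot>\<^sub>m A"
  by (rule eq_matI) (use assms in \<open>auto simp: mat_sum_def\<close>)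

lemma mat_trace_sum:
  fixes F :: "'i \<Rightarrow> 'a::comm_monoid_add mat"
  assumes "\<And>s. s \<in> S \<Longrightarrow> F s \<in> carrier_mat n n"
  shows "mat_trace (mat_sum n n F S) = (\<Sum>s\<in>S. mat_trace (F s))"
proof -
  have "mat_trace (mat_sum n n F S) = (\<Sum>i<n. \<Sum>s\<in>S. F s $$ (i, i))"
    by (auto simp: mat_trace_def mat_sum_def)
  also have "\<dots> = (\<Sum>s\<in>S. mat_trace (F s))"
    using assms by (subst sum.swap, intro sum.cong) (auto simp: mat_trace_def)
  finally show ?thesis .
qed

section \<open>Full rank factorizations\<close>

text \<open>
  The left inverse is \<open>(A\<^sup>* A)\<^sup>-\<^sup>1 A\<^sup>*\<close> with \<open>A\<^sup>*\<close> the conjugate transpose: if \<open>A\<^sup>* A v = 0\<close> then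
  \<open>|A v|\<^sup>2 = v\<^sup>* A\<^sup>* A v = 0\<close>, so that \<open>A\<^sup>* A\<close> is injective.
\<close>

lemma injective_mat_left_inverse:
  fixes A :: "complex mat"
  assumes A: "A \<in> carrier_mat n r"
    and inj: "\<And>v. v \<in> carrier_vec r \<Longrightarrow> A *\<^sub>v v = 0\<^sub>v n \<Longrightarrow> v = 0\<^sub>v r"
  shows "\<exists>L \<in> carrier_mat r n. L * A = 1\<^sub>m r"
proof -
  define H where "H = mat r n (\<lambda>(i, j). cnj (A $$ (j, i)))"
  have H: "H \<in> carrier_mat r n" by (simp add: H_def)
  have HA: "H * A \<in> carrier_mat r r" using A H by simp
  have "v = 0\<^sub>v r" if v: "v \<in> carrier_vec r" and HAv: "(H * A) *\<^sub>v v = 0\<^sub>v r" for v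
  proof (rule inj[OF v])
    define w where "w = A *\<^sub>v v"
    have w: "w \<in> carrier_vec n" using A v by (simp add: w_def)
    have Hw: "H *\<^sub>v w = 0\<^sub>v r" using HAv A H v by (simp add: w_def)
    have wi: "w $ i = (\<Sum>l<r. A $$ (i, l) * v $ l)" if "i < n" for i
      using that A v by (auto simp: w_def mult_mat_vec_def scalar_prod_def atLeast0LessThan intro!: sum.cong)
    have Hl: "(\<Sum>i<n. cnj (A $$ (i, l)) * w $ i) = 0" if l: "l < r" for l
    proof -
      have "(H *\<^sub>v w) $ l = (\<Sum>i<n. cnj (A $$ (i, l)) * w $ i)"
        using l w H A by (auto simp: H_def mult_mat_vec_def scalar_prod_def atLeast0LessThan intro!: sum.cong)
      thus ?thesis using Hw l by simp
    qed
    have "(\<Sum>i<n. cnj (w $ i) * w $ i) = (\<Sum>i<n. \<Sum>l<r. cnj (v $ l) * (cnj (A $$ (i, l)) * w $ i))"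
      by (intro sum.cong refl, subst wi) (auto simp: sum_distrib_left sum_distrib_right mult_ac intro!: sum.cong)
    also have "\<dots> = (\<Sum>l<r. cnj (v $ l) * (\<Sum>i<n. cnj (A $$ (i, l)) * w $ i))"
      by (subst sum.swap) (simp add: sum_distrib_left)
    also have "\<dots> = 0" by (simp add: Hl)
    finally have "(\<Sum>i<n. of_real ((cmod (w $ i))\<^sup>2)) = (0::complex)"
      by (simp add: complex_norm_square mult.commute del: of_real_power)
    hence "of_real (\<Sum>i<n. (cmod (w $ i))\<^sup>2) = (0::complex)" by simp
    hence "(\<Sum>i<n. (cmod (w $ i))\<^sup>2) = 0" by (simp only: of_real_eq_0_iff)
    hence "\<forall>i<n. w $ i = 0" by (subst (asm) sum_nonneg_eq_0_iff) auto
    thus "A *\<^sub>v v = 0\<^sub>v n" using w by (intro eq_vecI) (auto simp: w_def[symmetric])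
  qed
  hence "det (H * A) \<noteq> 0" using det_0_iff_vec_prod_zero[OF HA] by blast
  from det_non_zero_imp_unit[OF HA this, of undefined] obtain B where
    B: "B \<in> carrier_mat r r" "B * (H * A) = 1\<^sub>m r"
    by (auto simp: Units_def ring_mat_def)
  have "B * H \<in> carrier_mat r n" "(B * H) * A = 1\<^sub>m r"
    using B H A by (auto simp: assoc_mult_mat[OF B(1) H A])
  thus ?thesis by blast
qed

text \<open>
  A relation \<open>\<Sum>\<^sub>l x\<^sub>l c\<^sub>l = 0\<close> between the columns of the left factor with \<open>x\<^sub>k \<noteq> 0\<close> expresses column \<open>k\<close>
  by the others. Absorbing this into the rows of the right factor removes \<open>k\<close> from the index set
  of the factorization.
\<close>

lemma minimal_factorization_independent:
  fixes c :: "nat \<Rightarrow> 'k \<Rightarrow> complex" and r :: "'k \<Rightarrow> nat \<Rightarrow> complex"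
  assumes S: "finite S"
    and A: "\<And>i j. i < n \<Longrightarrow> j < m \<Longrightarrow> A i j = (\<Sum>l\<in>S. c i l * r l j)"
    and min: "\<And>T (c'::nat \<Rightarrow> 'k \<Rightarrow> complex) r'. finite T \<Longrightarrow>
      (\<forall>i<n. \<forall>j<m. A i j = (\<Sum>l\<in>T. c' i l * r' l j)) \<Longrightarrow> card S \<le> card T"
    and x: "\<And>i. i < n \<Longrightarrow> (\<Sum>l\<in>S. c i l * x l) = 0" and k: "k \<in> S"
  shows "x k = 0"
proof (rule ccontr)
  assume xk: "x k \<noteq> 0"
  define r' where "r' l j = r l j - x l / x k * r k j" for l j
  have "A i j = (\<Sum>l\<in>S - {k}. c i l * r' l j)" if ij: "i < n" "j < m" for i j
  proof -
    have "c i k * r' k j = 0" using xk by (simp add: r'_def)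
    hence "(\<Sum>l\<in>S - {k}. c i l * r' l j) = (\<Sum>l\<in>S. c i l * r' l j)"
      using k S by (simp add: sum.remove)
    also have "\<dots> = (\<Sum>l\<in>S. c i l * r l j) - (\<Sum>l\<in>S. c i l * x l) * (r k j / x k)"
      unfolding r'_def sum_distrib_right sum_subtractf[symmetric]
      by (intro sum.cong) (auto simp: algebra_simps)
    also have "\<dots> = A i j" using A[OF ij] x[OF ij(1)] by simp
    finally show ?thesis by simp
  qed
  hence "card S \<le> card (S - {k})" using S by (intro min[of _ c r']) auto
  thus False using k S by (metis card_Diff1_less leD)
qed

text \<open>
  Factor \<open>A\<close> through a space of least dimension. Then the columns of the left factor are independent,
  and so are the rows of the right factor, by the same argument for the transpose.
\<close>

lemma full_rank_factorization:
  fixes A :: "complex mat"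
  assumes A: "A \<in> carrier_mat n m"
  obtains r C R L K where "C \<in> carrier_mat n r" "R \<in> carrier_mat r m" "A = C * R"
    "L \<in> carrier_mat r n" "L * C = 1\<^sub>m r" "K \<in> carrier_mat m r" "R * K = 1\<^sub>m r"
proof -
  define P where "P = (\<lambda>r. \<exists>S (c :: nat \<Rightarrow> nat \<Rightarrow> complex) (q :: nat \<Rightarrow> nat \<Rightarrow> complex). finite S \<and> card S = r \<and>
    (\<forall>i<n. \<forall>j<m. A $$ (i, j) = (\<Sum>l\<in>S. c i l * q l j)))"
  have "P m" unfolding P_def
    by (rule exI[of _ "{..<m}"], rule exI[of _ "\<lambda>i l. A $$ (i, l)"],
        rule exI[of _ "\<lambda>l j. if l = j then 1 else 0"]) (auto simp: if_distrib cong: if_cong)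
  define r where "r = (LEAST r. P r)"
  have Pr: "P r" unfolding r_def using \<open>P m\<close> by (rule LeastI)
  have min: "P k \<Longrightarrow> r \<le> k" for k unfolding r_def by (rule Least_le)
  from Pr obtain S and c q :: "nat \<Rightarrow> nat \<Rightarrow> complex" where S: "finite S" "card S = r"
    and fac: "\<And>i j. i < n \<Longrightarrow> j < m \<Longrightarrow> A $$ (i, j) = (\<Sum>l\<in>S. c i l * q l j)"
    unfolding P_def by blast
  obtain f where f: "bij_betw f {..<r} S"
    using ex_bij_betw_nat_finite[OF S(1)] S(2) by (auto simp: atLeast0LessThan)
  have finS: "f l \<in> S" if "l < r" for l using f that by (auto dest: bij_betwE)
  have finv: "the_inv_into {..<r} f (f l) = l" if "l < r" for l
    using f that by (intro the_inv_into_f_f) (auto simp: bij_betw_def)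
  have leq: "card S \<le> card T" if "finite T" "\<forall>i<n. \<forall>j<m. A $$ (i, j) = (\<Sum>l\<in>T. c' i l * r' l j)"
    for T and c' r' :: "nat \<Rightarrow> nat \<Rightarrow> complex"
    unfolding S(2) using that by (intro min) (auto simp: P_def)
  define C where "C = mat n r (\<lambda>(i, l). c i (f l))"
  define R where "R = mat r m (\<lambda>(l, j). q (f l) j)"
  have C: "C \<in> carrier_mat n r" and R: "R \<in> carrier_mat r m" by (auto simp: C_def R_def)
  have ACR: "A = C * R"
  proof (rule eq_matI)
    fix i j assume "i < dim_row (C * R)" "j < dim_col (C * R)"
    hence ij: "i < n" "j < m" using C R by auto
    have "(C * R) $$ (i, j) = (\<Sum>l<r. c i (f l) * q (f l) j)"
      using ij by (simp add: index_mult_mat_sum[OF C R]) (simp add: C_def R_def)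
    also have "\<dots> = A $$ (i, j)"
      by (simp add: fac[OF ij] sum.reindex_bij_betw[OF f, of "\<lambda>l. c i l * q l j"])
    finally show "A $$ (i, j) = (C * R) $$ (i, j)" by simp
  qed (use A C R in auto)
  have "v = 0\<^sub>v r" if v: "v \<in> carrier_vec r" and Cv: "C *\<^sub>v v = 0\<^sub>v n" for v
  proof -
    define x where "x s = v $ the_inv_into {..<r} f s" for s
    have rel: "(\<Sum>s\<in>S. c i s * x s) = 0" if i: "i < n" for i
    proof -
      have "(\<Sum>s\<in>S. c i s * x s) = (\<Sum>l<r. c i (f l) * v $ l)"
        by (simp add: sum.reindex_bij_betw[OF f, symmetric] x_def finv)
      also have "\<dots> = (C *\<^sub>v v) $ i"
        using i v by (auto simp: C_def mult_mat_vec_def scalar_prod_def atLeast0LessThan intro!: sum.cong)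
      finally show ?thesis using Cv i by simp
    qed
    have "x s = 0" if "s \<in> S" for s
      by (rule minimal_factorization_independent[OF S(1) fac leq rel that])
    hence "x (f l) = 0" if "l < r" for l using finS[OF that] by blast
    hence "v $ l = 0" if "l < r" for l using finv[OF that] that by (metis x_def)
    thus ?thesis using v by (intro eq_vecI) auto
  qed
  from injective_mat_left_inverse[OF C this] obtain L where L: "L \<in> carrier_mat r n" and LC: "L * C = 1\<^sub>m r" by blast
  have "v = 0\<^sub>v r" if v: "v \<in> carrier_vec r" and Rv: "R\<^sup>T *\<^sub>v v = 0\<^sub>v m" for v
  proof -
    define x where "x s = v $ the_inv_into {..<r} f s" for s
    have rel: "(\<Sum>s\<in>S. q s j * x s) = 0" if j: "j < m" for j
    proof -
      have "(\<Sum>s\<in>S. q s j * x s) = (\<Sum>l<r. q (f l) j * v $ l)"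
        by (simp add: sum.reindex_bij_betw[OF f, symmetric] x_def finv)
      also have "\<dots> = (R\<^sup>T *\<^sub>v v) $ j"
        using j v by (auto simp: R_def mult_mat_vec_def scalar_prod_def atLeast0LessThan intro!: sum.cong)
      finally show ?thesis using Rv j by simp
    qed
    have fac': "A $$ (i, j) = (\<Sum>l\<in>S. q l j * c i l)" if "j < m" "i < n" for i j
      using fac that by (simp add: mult.commute)
    have leq': "card S \<le> card T" if "finite T" "\<forall>j<m. \<forall>i<n. A $$ (i, j) = (\<Sum>l\<in>T. c' j l * r' l i)"
      for T and c' r' :: "nat \<Rightarrow> nat \<Rightarrow> complex"
      using leq[of T "\<lambda>i l. r' l i" "\<lambda>l j. c' j l"] that by (simp add: mult.commute)
    have "x s = 0" if "s \<in> S" for s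
      by (rule minimal_factorization_independent[where A = "\<lambda>j i. A $$ (i, j)" and
            c = "\<lambda>j l. q l j" and r = "\<lambda>l i. c i l", OF S(1) fac' leq' rel that])
    hence "x (f l) = 0" if "l < r" for l using finS[OF that] by blast
    hence "v $ l = 0" if "l < r" for l using finv[OF that] that by (metis x_def)
    thus ?thesis using v by (intro eq_vecI) auto
  qed
  hence "\<exists>K'\<in>carrier_mat r m. K' * R\<^sup>T = 1\<^sub>m r"
    using R by (intro injective_mat_left_inverse) auto
  then obtain K' where K': "K' \<in> carrier_mat r m" "K' * R\<^sup>T = 1\<^sub>m r" by blast
  have "(K' * R\<^sup>T)\<^sup>T = R * K'\<^sup>T" using K'(1) R by (subst transpose_mult[of _ r m _ r]) auto
  hence "R * K'\<^sup>T = 1\<^sub>m r" using K'(2) by simp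
  moreover have "K'\<^sup>T \<in> carrier_mat m r" using K' by simp
  ultimately show ?thesis using that[OF C R ACR L LC] by blast
qed

text \<open>
  With \<open>A = C R\<close>, \<open>L C = 1\<close> and \<open>R K = 1\<close> one may take \<open>K L\<close>.
\<close>

lemma generalized_inverse:
  fixes A :: "complex mat"
  assumes A: "A \<in> carrier_mat n m"
  shows "\<exists>H\<in>carrier_mat m n. A * H * A = A"
proof -
  obtain r C R L K where C: "C \<in> carrier_mat n r" and R: "R \<in> carrier_mat r m" and ACR: "A = C * R"
    and L: "L \<in> carrier_mat r n" and LC: "L * C = 1\<^sub>m r" and K: "K \<in> carrier_mat m r" and RK: "R * K = 1\<^sub>m r"
    using full_rank_factorization[OF A] .
  have "A * (K * L) * A = A" using C R L K
    by (simp add: ACR mult_mat_assoc_dim cancel_inverse_mat[OF RK R K] cancel_inverse_mat[OF LC L C])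
  thus ?thesis using K L by (intro bexI[of _ "K * L"]) auto
qed

lemma idempotent_factorization:
  fixes e :: "complex mat"
  assumes e: "e \<in> carrier_mat n n" and ee: "e * e = e"
  obtains r C R where "C \<in> carrier_mat n r" "R \<in> carrier_mat r n" "e = C * R" "R * C = 1\<^sub>m r"
    "mat_trace e = of_nat r"
proof -
  obtain r C R L K where C: "C \<in> carrier_mat n r" and R: "R \<in> carrier_mat r n" and eCR: "e = C * R"
    and L: "L \<in> carrier_mat r n" and LC: "L * C = 1\<^sub>m r" and K: "K \<in> carrier_mat n r" and RK: "R * K = 1\<^sub>m r"
    using full_rank_factorization[OF e] .
  have "L * (e * e) * K = R * C"
    using C R L K by (simp add: eCR mult_mat_assoc_dim cancel_inverse_mat[OF LC L C] RK)
  moreover have "L * e * K = 1\<^sub>m r"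
    using C R L K by (simp add: eCR mult_mat_assoc_dim cancel_inverse_mat[OF LC L C] RK)
  ultimately have "R * C = 1\<^sub>m r" using ee by simp
  moreover from this have "mat_trace e = of_nat r"
    using mat_trace_mult_comm[OF C R] by (simp add: eCR mat_trace_one)
  ultimately show ?thesis using that[OF C R eCR] by simp
qed

section \<open>Matrices of finite order\<close>

lemma upper_triangular_mult:
  fixes A B :: "'a::comm_semiring_1 mat"
  assumes A: "A \<in> carrier_mat n n" "upper_triangular A" and B: "B \<in> carrier_mat n n" "upper_triangular B"
  shows "upper_triangular (A * B)"
    and "i < n \<Longrightarrow> (A * B) $$ (i, i) = A $$ (i, i) * B $$ (i, i)"
proof -
  have Az: "A $$ (i, j) = 0" if "j < i" "i < n" for i j using A that by auto
  have Bz: "B $$ (i, j) = 0" if "j < i" "i < n" for i j using B that by auto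
  show "upper_triangular (A * B)"
  proof
    fix i j assume ij: "j < i" "i < dim_row (A * B)"
    hence "i < n" "j < n" using A by auto
    hence "(A * B) $$ (i, j) = (\<Sum>l<n. A $$ (i, l) * B $$ (l, j))"
      by (intro index_mult_mat_sum[OF A(1) B(1)])
    also have "\<dots> = 0"
    proof (intro sum.neutral ballI)
      fix l assume "l \<in> {..<n}"
      thus "A $$ (i, l) * B $$ (l, j) = 0"
        using Az[of l i] Bz[of j l] ij \<open>i < n\<close> by (cases "l < i") auto
    qed
    finally show "(A * B) $$ (i, j) = 0" .
  qed
  show "(A * B) $$ (i, i) = A $$ (i, i) * B $$ (i, i)" if i: "i < n"
  proof -
    have "(A * B) $$ (i, i) = (\<Sum>l<n. A $$ (i, l) * B $$ (l, i))"
      by (rule index_mult_mat_sum[OF A(1) B(1) i i])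
    also have "\<dots> = (\<Sum>l<n. if l = i then A $$ (i, i) * B $$ (i, i) else 0)"
    proof (intro sum.cong refl)
      fix l assume "l \<in> {..<n}"
      thus "A $$ (i, l) * B $$ (l, i) = (if l = i then A $$ (i, i) * B $$ (i, i) else 0)"
        using Az[of l i] Bz[of i l] i by (cases l i rule: linorder_cases) auto
    qed
    also have "\<dots> = A $$ (i, i) * B $$ (i, i)" using i by simp
    finally show ?thesis .
  qed
qed

lemma upper_triangular_pow:
  fixes A :: "'a::comm_semiring_1 mat"
  assumes A: "A \<in> carrier_mat n n" "upper_triangular A"
  shows "upper_triangular (A ^\<^sub>m k) \<and> (\<forall>i<n. (A ^\<^sub>m k) $$ (i, i) = A $$ (i, i) ^ k)"
proof (induction k)
  case 0
  then show ?case using A by auto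
next
  case (Suc k)
  have "A ^\<^sub>m k \<in> carrier_mat n n" using A by simp
  from upper_triangular_mult[OF this _ A] Suc show ?case by (simp add: mult.commute)
qed

text \<open>
  \<open>t\<close> lists the diagonal of a triangular form of \<open>A\<close>: taking powers of a triangular matrix raises its
  diagonal entries to powers, and these entries are roots of unity because \<open>A\<^sup>N = 1\<close>.
\<close>

lemma trace_powers_eigenvalues:
  fixes A :: "complex mat"
  assumes A: "A \<in> carrier_mat n n" and AN: "A ^\<^sub>m N = 1\<^sub>m n"
  obtains t :: "nat \<Rightarrow> complex"
  where "\<And>i. i < n \<Longrightarrow> t i ^ N = 1" "\<And>k. mat_trace (A ^\<^sub>m k) = (\<Sum>i<n. t i ^ k)"
proof -
  obtain es where "char_poly A = (\<Prod>a\<leftarrow>es. [:- a, 1:])"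
    using char_poly_factorized[OF A] by blast
  from schur_decomposition_exists[OF A this] obtain B where B: "B \<in> carrier_mat n n"
    "upper_triangular B" and "similar_mat A B" by blast
  then obtain P Q where wit: "similar_mat_wit A B P Q" unfolding similar_mat_def by blast
  from similar_mat_witD2[OF A wit] have PQ: "P * Q = 1\<^sub>m n" "Q * P = 1\<^sub>m n"
    and P: "P \<in> carrier_mat n n" and Q: "Q \<in> carrier_mat n n" by auto
  have Ak: "A ^\<^sub>m k = P * B ^\<^sub>m k * Q" for k by (rule similar_mat_wit_pow_id[OF wit])
  have Bk: "B ^\<^sub>m k \<in> carrier_mat n n" for k using B by simp
  have diag: "(B ^\<^sub>m k) $$ (i, i) = B $$ (i, i) ^ k" if "i < n" for i k
    using upper_triangular_pow[OF B] that by blast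
  have tr: "mat_trace (A ^\<^sub>m k) = (\<Sum>i<n. B $$ (i, i) ^ k)" for k
  proof -
    have "mat_trace (A ^\<^sub>m k) = mat_trace (Q * (P * B ^\<^sub>m k))"
      unfolding Ak by (rule mat_trace_mult_comm[OF _ Q]) (use P Bk in simp)
    also have "Q * (P * B ^\<^sub>m k) = B ^\<^sub>m k"
      by (rule cancel_inverse_mat[OF PQ(2) Q P]) (use Bk[of k] in auto)
    also have "mat_trace (B ^\<^sub>m k) = (\<Sum>i<n. B $$ (i, i) ^ k)"
      unfolding mat_trace_def using Bk[of k] by (intro sum.cong) (auto simp: diag)
    finally show ?thesis .
  qed
  have "B ^\<^sub>m N = Q * (P * B ^\<^sub>m N)"
    by (rule cancel_inverse_mat[OF PQ(2) Q P, symmetric]) (use Bk[of N] in auto)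
  also have "P * B ^\<^sub>m N = P * B ^\<^sub>m N * (Q * P)" using P Bk[of N]
    by (simp add: PQ right_mult_one_mat[of _ n n])
  also have "\<dots> = A ^\<^sub>m N * P"
    unfolding Ak using P Q B(1) by (simp add: mult_mat_assoc_dim)
  also have "\<dots> = P" using AN P by simp
  finally have BN: "B ^\<^sub>m N = 1\<^sub>m n" using PQ by simp
  have "B $$ (i, i) ^ N = 1" if "i < n" for i
    using diag[OF that, of N] that by (simp add: BN)
  thus ?thesis using tr that[of "\<lambda>i. B $$ (i, i)"] by blast
qed

section \<open>Homomorphisms and characters\<close>

locale fin_group = group G for G (structure) +
  assumes fin_carrier [simp]: "finite (carrier G)"

definition character :: "'g cmod \<Rightarrow> 'g \<Rightarrow> complex" where
  "character M g = mat_trace (act M g)"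

definition cg_hom :: "('g, 'b) monoid_scheme \<Rightarrow> 'g cmod \<Rightarrow> 'g cmod \<Rightarrow> complex mat set" where
  "cg_hom G V W = {f \<in> carrier_mat (vdim W) (vdim V). \<forall>g\<in>carrier G. f * act V g = act W g * f}"

lemma cg_homI:
  assumes "f \<in> carrier_mat (vdim W) (vdim V)"
    and "\<And>g. g \<in> carrier G \<Longrightarrow> f * act V g = act W g * f"
  shows "f \<in> cg_hom G V W"
  using assms by (simp add: cg_hom_def)

lemma cg_homD:
  assumes "f \<in> cg_hom G V W"
  shows "f \<in> carrier_mat (vdim W) (vdim V)"
    and "g \<in> carrier G \<Longrightarrow> f * act V g = act W g * f"
  using assms by (auto simp: cg_hom_def)

context fin_group
begin

abbreviation "gmod \<equiv> cg_module G"
abbreviation "ghom \<equiv> cg_hom G"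

lemma order_pos: "order G > 0"
  using order_gt_0_iff_finite by simp

lemma act_carrier: "gmod V \<Longrightarrow> g \<in> carrier G \<Longrightarrow> act V g \<in> carrier_mat (vdim V) (vdim V)"
  by (simp add: cg_module_def)

lemma act_one: "gmod V \<Longrightarrow> act V \<one> = 1\<^sub>m (vdim V)"
  by (simp add: cg_module_def)

lemma act_mult: "gmod V \<Longrightarrow> g \<in> carrier G \<Longrightarrow> h \<in> carrier G \<Longrightarrow> act V (g \<otimes> h) = act V g * act V h"
  by (simp add: cg_module_def)

lemma act_inv: "gmod V \<Longrightarrow> g \<in> carrier G \<Longrightarrow> act V g * act V (inv g) = 1\<^sub>m (vdim V)"
  by (simp add: act_mult[symmetric] act_one)

lemma act_inv': "gmod V \<Longrightarrow> g \<in> carrier G \<Longrightarrow> act V (inv g) * act V g = 1\<^sub>m (vdim V)"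
  by (simp add: act_mult[symmetric] act_one)

lemma act_pow: "gmod V \<Longrightarrow> g \<in> carrier G \<Longrightarrow> act V (g [^] (k::nat)) = act V g ^\<^sub>m k"
proof (induction k)
  case 0
  then show ?case using act_carrier[of V g] by (simp add: act_one)
next
  case (Suc k)
  then show ?case by (simp add: act_mult)
qed

lemma character_one: "gmod V \<Longrightarrow> character V \<one> = of_nat (vdim V)"
  by (simp add: character_def act_one mat_trace_one)

lemma character_conj:
  assumes "gmod V" "g \<in> carrier G" "c \<in> carrier G"
  shows "character V (c \<otimes> g \<otimes> inv c) = character V g"
proof -
  have c: "act V g \<in> carrier_mat (vdim V) (vdim V)" "act V c \<in> carrier_mat (vdim V) (vdim V)"
    "act V (inv c) \<in> carrier_mat (vdim V) (vdim V)"
    using assms by (auto intro: act_carrier)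
  have "character V (c \<otimes> g \<otimes> inv c) = mat_trace (act V c * act V g * act V (inv c))"
    using assms by (simp add: character_def act_mult)
  also have "\<dots> = mat_trace (act V (inv c) * (act V c * act V g))"
    by (rule mat_trace_mult_comm) (use c in auto)
  also have "act V (inv c) * (act V c * act V g) = act V g"
    by (rule cancel_inverse_mat[OF act_inv']) (use assms c in auto)
  finally show ?thesis by (simp add: character_def)
qed

lemma character_eigenvalues:
  assumes "gmod V" "g \<in> carrier G"
  obtains t :: "nat \<Rightarrow> complex"
  where "\<And>i. i < vdim V \<Longrightarrow> t i ^ order G = 1"
    "\<And>k::nat. character V (g [^] k) = (\<Sum>i<vdim V. t i ^ k)"
proof -
  have "act V g ^\<^sub>m order G = 1\<^sub>m (vdim V)"
    using assms pow_order_eq_1 by (simp add: act_pow[symmetric] act_one)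
  from trace_powers_eigenvalues[OF act_carrier[OF assms] this] that show ?thesis
    unfolding character_def act_pow[OF assms] by metis
qed

text \<open>
  The eigenvalues of a matrix of finite order lie on the unit circle, where inversion is complex
  conjugation.
\<close>

lemma character_inv:
  assumes V: "gmod V" and g: "g \<in> carrier G"
  shows "character V (inv g) = cnj (character V g)"
proof -
  obtain t where t: "\<And>i. i < vdim V \<Longrightarrow> t i ^ order G = 1"
    and chi: "\<And>k::nat. character V (g [^] k) = (\<Sum>i<vdim V. t i ^ k)"
    using character_eigenvalues[OF assms] by metis
  define m where "m = order G - 1"
  have m: "order G = Suc m" using order_pos by (simp add: m_def)
  have "g [^] m \<otimes> g = \<one>" using pow_order_eq_1[OF g] by (simp add: m)
  hence "inv g = g [^] m" using g by (intro inv_equality) auto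
  moreover have "t i ^ m = cnj (t i)" if "i < vdim V" for i
  proof -
    have 1: "t i * t i ^ m = 1" using t[OF that] by (simp add: m)
    have "cmod (t i) = 1"
      using power_eq_imp_eq_norm[of "t i" "order G" 1] t[OF that] order_pos by simp
    hence 2: "t i * cnj (t i) = 1" by (simp add: complex_norm_square[symmetric])
    hence "t i \<noteq> 0" by auto
    thus ?thesis using 1 2 by (metis mult_left_cancel)
  qed
  ultimately show ?thesis using chi[of m] chi[of 1] g by simp
qed

lemma id_hom: "gmod V \<Longrightarrow> 1\<^sub>m (vdim V) \<in> ghom V V"
  by (rule cg_homI) (auto dest: act_carrier)

lemma hom_comp:
  assumes "gmod U" "gmod V" "gmod W" "f \<in> ghom V W" "h \<in> ghom U V"
  shows "f * h \<in> ghom U W"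
proof (rule cg_homI)
  note f = cg_homD[OF assms(4)] and h = cg_homD[OF assms(5)]
  show "f * h \<in> carrier_mat (vdim W) (vdim U)" using f(1) h(1) by simp
  fix g assume g: "g \<in> carrier G"
  note c = act_carrier[OF assms(1) g] act_carrier[OF assms(2) g] act_carrier[OF assms(3) g]
  have "f * h * act U g = f * (h * act U g)" using c f(1) h(1) by (intro assoc_mult_mat) auto
  also have "\<dots> = f * (act V g * h)" by (simp add: h(2)[OF g])
  also have "\<dots> = f * act V g * h" using c f(1) h(1) by (intro assoc_mult_mat[symmetric]) auto
  also have "\<dots> = act W g * f * h" by (simp add: f(2)[OF g])
  also have "\<dots> = act W g * (f * h)" using c f(1) h(1) by (intro assoc_mult_mat) auto
  finally show "f * h * act U g = act W g * (f * h)" .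
qed

lemma hom_add:
  assumes "gmod V" "gmod W" "f \<in> ghom V W" "h \<in> ghom V W"
  shows "f + h \<in> ghom V W"
proof (rule cg_homI)
  note f = cg_homD[OF assms(3)] and h = cg_homD[OF assms(4)]
  show "f + h \<in> carrier_mat (vdim W) (vdim V)" using f(1) h(1) by simp
  fix g assume g: "g \<in> carrier G"
  note c = act_carrier[OF assms(1) g] act_carrier[OF assms(2) g]
  show "(f + h) * act V g = act W g * (f + h)"
    using f(2)[OF g] h(2)[OF g] by (simp add: add_mult_distrib_mat[OF f(1) h(1) c(1)] mult_add_distrib_mat[OF c(2) f(1) h(1)])
qed

lemma hom_smult:
  assumes "gmod V" "gmod W" "f \<in> ghom V W"
  shows "c \<cdot>\<^sub>m f \<in> ghom V W"
proof (rule cg_homI)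
  note f = cg_homD[OF assms(3)]
  show "c \<cdot>\<^sub>m f \<in> carrier_mat (vdim W) (vdim V)" using f(1) by simp
  fix g assume g: "g \<in> carrier G"
  note c = act_carrier[OF assms(1) g] act_carrier[OF assms(2) g]
  show "(c \<cdot>\<^sub>m f) * act V g = act W g * (c \<cdot>\<^sub>m f)"
    using f(2)[OF g] by (simp add: mult_smult_assoc_mat[OF f(1) c(1)] mult_smult_distrib[OF c(2) f(1)])
qed

lemma hom_minus:
  assumes "gmod V" "gmod W" "f \<in> ghom V W" "h \<in> ghom V W"
  shows "f - h \<in> ghom V W"
proof -
  note f = cg_homD(1)[OF assms(3)] and h = cg_homD(1)[OF assms(4)]
  have "f - h = f + (-1) \<cdot>\<^sub>m h" by (rule eq_matI) (use f h in auto)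
  thus ?thesis using hom_add[OF assms(1,2,3) hom_smult[OF assms(1,2,4)]] by metis
qed

definition hom_avg :: "'a cmod \<Rightarrow> 'a cmod \<Rightarrow> complex mat \<Rightarrow> complex mat" where
  "hom_avg V W B =
     mat_sum (vdim W) (vdim V) (\<lambda>g. act W g * B * act V (inv g)) (carrier G)"

lemma hom_avg_carrier:
  assumes "gmod V" "gmod W" "B \<in> carrier_mat (vdim W) (vdim V)" "g \<in> carrier G"
  shows "act W g * B * act V (inv g) \<in> carrier_mat (vdim W) (vdim V)"
  using assms act_carrier[OF assms(1), of "inv g"] act_carrier[OF assms(2,4)] by auto

lemma hom_avg_hom:
  assumes V: "gmod V" and W: "gmod W" and B: "B \<in> carrier_mat (vdim W) (vdim V)"
  shows "hom_avg V W B \<in> ghom V W"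
proof (rule cg_homI)
  show "hom_avg V W B \<in> carrier_mat (vdim W) (vdim V)" by (simp add: hom_avg_def)
  fix h assume h: "h \<in> carrier G"
  note cV = act_carrier[OF V] and cW = act_carrier[OF W]
  have bij: "bij_betw (\<lambda>g. h \<otimes> g) (carrier G) (carrier G)"
    by (rule bij_betwI[where g = "\<lambda>g. inv h \<otimes> g"]) (use h in \<open>auto simp: m_assoc[symmetric]\<close>)
  have "hom_avg V W B * act V h =
      mat_sum (vdim W) (vdim V) (\<lambda>g. act W g * B * act V (inv g) * act V h) (carrier G)"
    unfolding hom_avg_def by (rule mat_sum_mult) (use h cV hom_avg_carrier[OF assms] in auto)
  also have "\<dots> = mat_sum (vdim W) (vdim V)
      (\<lambda>g. act W (h \<otimes> g) * B * act V (inv (h \<otimes> g)) * act V h) (carrier G)"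
    by (rule mat_sum_reindex[OF bij])
  also have "\<dots> = mat_sum (vdim W) (vdim V) (\<lambda>g. act W h * (act W g * B * act V (inv g))) (carrier G)"
  proof (rule mat_sum_cong)
    fix g assume g: "g \<in> carrier G"
    have "act V (inv (h \<otimes> g)) * act V h = act V (inv g)"
      using g h V by (simp add: act_mult[symmetric] inv_mult_group m_assoc)
    moreover have "act W (h \<otimes> g) * B * act V (inv (h \<otimes> g)) * act V h =
        act W h * (act W g * (B * (act V (inv (h \<otimes> g)) * act V h)))"
      using g h B cV[of "inv (h \<otimes> g)"] cV[of h] cW[of h] cW[of g]
      by (simp add: act_mult[OF W] mult_mat_assoc_dim)
    ultimately show "act W (h \<otimes> g) * B * act V (inv (h \<otimes> g)) * act V h =
        act W h * (act W g * B * act V (inv g))"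
      using g h B cV[of "inv g"] cW[of g] by (simp add: mult_mat_assoc_dim)
  qed
  also have "\<dots> = act W h * hom_avg V W B"
    unfolding hom_avg_def by (rule mult_mat_sum[symmetric]) (use h cW hom_avg_carrier[OF assms] in auto)
  finally show "hom_avg V W B * act V h = act W h * hom_avg V W B" .
qed

text \<open>
  Maschke: averaging a generalized inverse of \<open>f\<close> over the group makes it equivariant, because
  \<open>f\<close> can be moved through the action and \<open>f H f = f\<close> is then summed \<open>|G|\<close> times.
\<close>

lemma hom_generalized_inverse:
  assumes V: "gmod V" and W: "gmod W" and f: "f \<in> ghom V W"
  obtains h where "h \<in> ghom W V" "f * h * f = f" "h * f * h = h"
proof -
  note fc = cg_homD(1)[OF f]
  obtain H where H: "H \<in> carrier_mat (vdim V) (vdim W)" "f * H * f = f"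
    using generalized_inverse[OF fc] by blast
  note cV = act_carrier[OF V] and cW = act_carrier[OF W]
  define c where "c = inverse (of_nat (order G) :: complex)"
  define A where "A = hom_avg W V H"
  have A: "A \<in> ghom W V" unfolding A_def by (rule hom_avg_hom[OF W V H(1)])
  note Ac = cg_homD(1)[OF A]
  have t: "act V g * H * act W (inv g) \<in> carrier_mat (vdim V) (vdim W)" if "g \<in> carrier G" for g
    by (rule hom_avg_carrier[OF W V H(1) that])
  have "f * A = mat_sum (vdim W) (vdim W) (\<lambda>g. f * (act V g * H * act W (inv g))) (carrier G)"
    unfolding A_def hom_avg_def by (rule mult_mat_sum[OF fc]) (use t in auto)
  hence "f * A * f = mat_sum (vdim W) (vdim V) (\<lambda>g. f * (act V g * H * act W (inv g)) * f) (carrier G)"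
    using t fc by (simp add: mat_sum_mult[OF fc])
  also have "\<dots> = mat_sum (vdim W) (vdim V) (\<lambda>_. f) (carrier G)"
  proof (rule mat_sum_cong)
    fix g assume g: "g \<in> carrier G"
    have ig: "inv g \<in> carrier G" using g by simp
    have 1: "act W (inv g) * f = f * act V (inv g)" using cg_homD(2)[OF f ig] by simp
    have 2: "f * (act V g * X) = act W g * (f * X)" if "dim_row X = vdim V" for X
    proof -
      have "f * (act V g * X) = f * act V g * X"
        by (rule mult_mat_assoc_dim[symmetric]) (use fc cV[OF g] that in auto)
      also have "\<dots> = act W g * f * X" by (simp add: cg_homD(2)[OF f g])
      also have "\<dots> = act W g * (f * X)"
        by (rule mult_mat_assoc_dim) (use fc cW[OF g] that in auto)
      finally show ?thesis .
    qed
    have "f * (act V g * H * act W (inv g)) * f = f * (act V g * (H * (act W (inv g) * f)))"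
      using fc H cV[OF g] cW[OF ig] by (simp add: mult_mat_assoc_dim)
    also have "\<dots> = act W g * (f * (H * (f * act V (inv g))))"
      unfolding 1 by (rule 2) (use H in auto)
    also have "f * (H * (f * act V (inv g))) = f * H * f * act V (inv g)"
      using fc H(1) cV[OF ig] by (simp add: mult_mat_assoc_dim)
    also have "\<dots> = act W (inv g) * f" unfolding H(2) 1 ..
    also have "act W g * (act W (inv g) * f) = f"
      by (rule cancel_inverse_mat[OF act_inv[OF W g]]) (use cW[OF g] cW[OF ig] fc in auto)
    finally show "f * (act V g * H * act W (inv g)) * f = f" .
  qed
  also have "\<dots> = of_nat (order G) \<cdot>\<^sub>m f"
    by (simp add: mat_sum_const[OF fc] Coset.order_def)
  finally have fAf: "f * A * f = of_nat (order G) \<cdot>\<^sub>m f" .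
  define k where "k = c \<cdot>\<^sub>m A"
  have k: "k \<in> ghom W V" unfolding k_def by (rule hom_smult[OF W V A])
  have kc: "k \<in> carrier_mat (vdim V) (vdim W)" using cg_homD(1)[OF k] .
  have "f * k * f = c \<cdot>\<^sub>m (f * A * f)"
    unfolding k_def using fc Ac
    by (simp add: mult_smult_distrib[OF fc Ac] mult_smult_assoc_mat[of "f * A" "vdim W" "vdim W" f "vdim V"])
  also have "\<dots> = f" unfolding fAf c_def using order_pos by (intro eq_matI) auto
  finally have fkf: "f * k * f = f" .
  have red: "f * (k * (f * X)) = f * X" if "dim_row X = vdim V" for X
  proof -
    have "f * (k * (f * X)) = f * k * f * X" using fc kc that by (simp add: mult_mat_assoc_dim)
    thus ?thesis by (simp add: fkf)
  qed
  define h where "h = k * f * k"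
  have h: "h \<in> ghom W V" unfolding h_def by (rule hom_comp[OF W V V hom_comp[OF V W V k f] k])
  have fkf': "f * (k * f) = f" using fkf fc kc by (simp add: mult_mat_assoc_dim)
  have "f * h * f = f" unfolding h_def using fc kc
    by (simp add: mult_mat_assoc_dim red fkf')
  moreover have "h * f * h = h" unfolding h_def using fc kc
    by (simp add: mult_mat_assoc_dim red)
  ultimately show ?thesis using that h by blast
qed

text \<open>
  A factorization \<open>e = C R\<close> with \<open>R C = 1\<close> identifies the image of \<open>e\<close> with a coordinate space, on which
  \<open>g\<close> acts by \<open>R \<rho>(g) C\<close>. This is multiplicative because \<open>C R = e\<close> commutes with the action. The trace
  of \<open>e\<close> is the dimension of its image.
\<close>

lemma idempotent_summand:
  assumes V: "gmod V" and e: "e \<in> ghom V V" and ee: "e * e = e"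
  obtains A C R where "gmod A" "C \<in> ghom A V" "R \<in> ghom V A" "e = C * R" "R * C = 1\<^sub>m (vdim A)"
    "\<And>g. g \<in> carrier G \<Longrightarrow> character A g = mat_trace (act V g * e)" "of_nat (vdim A) = mat_trace e"
proof -
  note ec = cg_homD(1)[OF e] and cV = act_carrier[OF V]
  obtain r C R where C: "C \<in> carrier_mat (vdim V) r" and R: "R \<in> carrier_mat r (vdim V)"
    and eCR: "e = C * R" and RC: "R * C = 1\<^sub>m r" and tr: "mat_trace e = of_nat r"
    using idempotent_factorization[OF ec ee] by metis
  define A where "A = \<lparr>vdim = r, act = (\<lambda>g. R * act V g * C)\<rparr>"
  have [simp]: "vdim A = r" "act A g = R * act V g * C" for g by (auto simp: A_def)
  have Re: "R * e = R" unfolding eCR by (rule cancel_inverse_mat[OF RC R C]) (use R in auto)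
  have eC: "e * C = C" unfolding eCR using C R by (simp add: mult_mat_assoc_dim RC)
  have CRact: "C * (R * (act V g * X)) = act V g * (C * (R * X))" if g: "g \<in> carrier G" and "dim_row X = vdim V" for g X
  proof -
    have "C * (R * (act V g * X)) = (e * act V g) * X"
      unfolding eCR using C R cV[OF g] that by (simp add: mult_mat_assoc_dim)
    also have "\<dots> = (act V g * e) * X" by (simp add: cg_homD(2)[OF e g])
    also have "\<dots> = act V g * (C * (R * X))"
      unfolding eCR using C R cV[OF g] that by (simp add: mult_mat_assoc_dim)
    finally show ?thesis .
  qed
  have CRC: "C * (R * C) = C" using eC C R by (simp add: eCR mult_mat_assoc_dim)
  have CRact': "C * (R * (act V g * C)) = act V g * C" if g: "g \<in> carrier G" for g
    using CRact[OF g, of C] C by (simp add: CRC)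
  have A: "gmod A"
    unfolding cg_module_def
  proof (intro conjI ballI)
    show "act A \<one> = 1\<^sub>m (vdim A)" using R C RC by (simp add: act_one[OF V])
    fix g h assume g: "g \<in> carrier G" and h: "h \<in> carrier G"
    show "act A (g \<otimes> h) = act A g * act A h"
      using R C cV[OF g] cV[OF h] CRact'[OF h] by (simp add: act_mult[OF V g h] mult_mat_assoc_dim)
  qed (use R C cV in auto)
  have "C \<in> ghom A V"
  proof (rule cg_homI)
    fix g assume g: "g \<in> carrier G"
    show "C * act A g = act V g * C" using C R cV[OF g] CRact'[OF g] by (simp add: mult_mat_assoc_dim)
  qed (use C in simp)
  moreover have "R \<in> ghom V A"
  proof (rule cg_homI)
    fix g assume g: "g \<in> carrier G"
    have "R * act V g = R * e * act V g" by (simp add: Re)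
    also have "\<dots> = R * (act V g * e)"
      using R ec cV[OF g] by (simp add: mult_mat_assoc_dim cg_homD(2)[OF e g])
    also have "\<dots> = act A g * R" using R C cV[OF g] by (simp add: eCR mult_mat_assoc_dim)
    finally show "R * act V g = act A g * R" .
  qed (use R in simp)
  moreover have "character A g = mat_trace (act V g * e)" if g: "g \<in> carrier G" for g
  proof -
    have "character A g = mat_trace (R * (act V g * C))"
      using R C cV[OF g] by (simp add: character_def mult_mat_assoc_dim)
    also have "\<dots> = mat_trace (act V g * C * R)"
      by (rule mat_trace_mult_comm) (use R C cV[OF g] in auto)
    also have "act V g * C * R = act V g * e" using R C cV[OF g] by (simp add: eCR mult_mat_assoc_dim)
    finally show ?thesis .
  qed
  ultimately show ?thesis using that[OF A _ _ eCR] RC tr by simp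
qed


section \<open>Modules with equal characters are isomorphic\<close>

definition unit_mat :: "nat \<Rightarrow> nat \<Rightarrow> nat \<Rightarrow> nat \<Rightarrow> complex mat" where
  "unit_mat n m i j = mat n m (\<lambda>(a, b). if a = i \<and> b = j then 1 else 0)"

lemma unit_mat_carrier [simp]: "unit_mat n m i j \<in> carrier_mat n m"
  by (simp add: unit_mat_def)

lemma hom_avg_unit_entry:
  assumes V: "gmod V" and W: "gmod W"
    and k: "k < vdim W" and i: "i < vdim W" and j: "j < vdim V" and l: "l < vdim V"
  shows "hom_avg V W (unit_mat (vdim W) (vdim V) i j) $$ (k, l) =
    (\<Sum>g\<in>carrier G. act W g $$ (k, i) * act V (inv g) $$ (j, l))"
proof -
  have "(act W g * unit_mat (vdim W) (vdim V) i j * act V (inv g)) $$ (k, l) =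
      act W g $$ (k, i) * act V (inv g) $$ (j, l)" if g: "g \<in> carrier G" for g
  proof -
    note cW = act_carrier[OF W g] and cV = act_carrier[OF V, of "inv g"]
    have AE: "(act W g * unit_mat (vdim W) (vdim V) i j) $$ (k, b) =
        (if b = j then act W g $$ (k, i) else 0)" if b: "b < vdim V" for b
    proof -
      have "(act W g * unit_mat (vdim W) (vdim V) i j) $$ (k, b) =
          (\<Sum>a<vdim W. act W g $$ (k, a) * unit_mat (vdim W) (vdim V) i j $$ (a, b))"
        by (rule index_mult_mat_sum[OF cW unit_mat_carrier k b])
      also have "\<dots> = (\<Sum>a<vdim W. if a = i then (if b = j then act W g $$ (k, i) else 0) else 0)"
        using b by (intro sum.cong) (auto simp: unit_mat_def)
      finally show ?thesis using i by simp
    qed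
    have "(act W g * unit_mat (vdim W) (vdim V) i j * act V (inv g)) $$ (k, l) =
        (\<Sum>b<vdim V. (act W g * unit_mat (vdim W) (vdim V) i j) $$ (k, b) * act V (inv g) $$ (b, l))"
      by (rule index_mult_mat_sum[OF mult_carrier_mat[OF cW unit_mat_carrier] cV k l]) (use g in simp)
    also have "\<dots> = (\<Sum>b<vdim V. if b = j then act W g $$ (k, i) * act V (inv g) $$ (j, l) else 0)"
      by (intro sum.cong refl) (simp add: AE)
    finally show ?thesis using j by simp
  qed
  thus ?thesis using k l by (simp add: hom_avg_def mat_sum_def)
qed

text \<open>
  If every homomorphism \<open>V \<rightarrow> W\<close> vanished, the averages of the unit matrices would give
  \<open>\<Sum>\<^sub>g \<chi>(g) \<chi>(g\<^sup>-\<^sup>1) = 0\<close>, whereas this is a sum of squares of absolute values in which \<open>g = 1\<close>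
  contributes \<open>(dim V)\<^sup>2\<close>.
\<close>

lemma nonzero_hom_exists:
  assumes V: "gmod V" and W: "gmod W" and dim: "vdim V \<noteq> 0"
    and eq: "\<And>g. g \<in> carrier G \<Longrightarrow> character V g = character W g"
  obtains f where "f \<in> ghom V W" "f \<noteq> 0\<^sub>m (vdim W) (vdim V)"
proof (rule ccontr)
  assume "\<not> thesis"
  hence zero: "f = 0\<^sub>m (vdim W) (vdim V)" if "f \<in> ghom V W" for f
    using that \<open>\<And>f. f \<in> ghom V W \<Longrightarrow> f \<noteq> 0\<^sub>m (vdim W) (vdim V) \<Longrightarrow> thesis\<close> by blast
  have "(\<Sum>g\<in>carrier G. act W g $$ (i, i) * act V (inv g) $$ (j, j)) = 0"
    if ij: "i < vdim W" "j < vdim V" for i j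
  proof -
    have "hom_avg V W (unit_mat (vdim W) (vdim V) i j) = 0\<^sub>m (vdim W) (vdim V)"
      by (rule zero[OF hom_avg_hom[OF V W unit_mat_carrier]])
    thus ?thesis using hom_avg_unit_entry[OF V W ij(1,1) ij(2,2)] ij by simp
  qed
  hence "0 = (\<Sum>i<vdim W. \<Sum>j<vdim V. \<Sum>g\<in>carrier G. act W g $$ (i, i) * act V (inv g) $$ (j, j))"
    by simp
  also have "\<dots> = (\<Sum>i<vdim W. \<Sum>g\<in>carrier G. \<Sum>j<vdim V. act W g $$ (i, i) * act V (inv g) $$ (j, j))"
    by (intro sum.cong refl) (rule sum.swap)
  also have "\<dots> = (\<Sum>g\<in>carrier G. \<Sum>i<vdim W. \<Sum>j<vdim V. act W g $$ (i, i) * act V (inv g) $$ (j, j))"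
    by (rule sum.swap)
  also have "\<dots> = (\<Sum>g\<in>carrier G. character W g * character V (inv g))"
  proof (intro sum.cong refl)
    fix g assume g: "g \<in> carrier G"
    show "(\<Sum>i<vdim W. \<Sum>j<vdim V. act W g $$ (i, i) * act V (inv g) $$ (j, j)) =
        character W g * character V (inv g)"
      using act_carrier[OF W g] act_carrier[OF V inv_closed[OF g]]
      by (simp add: character_def mat_trace_def sum_product)
  qed
  also have "\<dots> = (\<Sum>g\<in>carrier G. of_real ((cmod (character V g))\<^sup>2))"
    by (intro sum.cong refl)
      (simp add: eq[symmetric] character_inv[OF V] complex_norm_square[symmetric])
  also have "\<dots> = of_real (\<Sum>g\<in>carrier G. (cmod (character V g))\<^sup>2)" by simp
  finally have "(\<Sum>g\<in>carrier G. (cmod (character V g))\<^sup>2) = 0" by (metis of_real_eq_0_iff)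
  hence "\<forall>g\<in>carrier G. (cmod (character V g))\<^sup>2 = 0"
    by (subst (asm) sum_nonneg_eq_0_iff) auto
  hence "character V \<one> = 0" by auto
  thus False using dim by (simp add: character_one[OF V])
qed

lemma idempotent_trace_zero:
  assumes V: "gmod V" and e: "e \<in> ghom V V" "e * e = e" "mat_trace e = 0"
  shows "e = 0\<^sub>m (vdim V) (vdim V)"
proof -
  obtain A C R where C: "C \<in> ghom A V" and R: "R \<in> ghom V A" and eCR: "e = C * R"
    and "of_nat (vdim A) = mat_trace e"
    using idempotent_summand[OF V e(1,2)] by metis
  hence A: "vdim A = 0" using e(3) by simp
  show ?thesis unfolding eCR
    using cg_homD(1)[OF C] cg_homD(1)[OF R] A by (intro eq_matI) (auto simp: scalar_prod_def)
qed

lemma idempotent_complement: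
  assumes V: "gmod V" and e: "e \<in> ghom V V" "e * e = e"
  shows "1\<^sub>m (vdim V) - e \<in> ghom V V"
    "(1\<^sub>m (vdim V) - e) * (1\<^sub>m (vdim V) - e) = 1\<^sub>m (vdim V) - e"
    "g \<in> carrier G \<Longrightarrow> mat_trace (act V g * (1\<^sub>m (vdim V) - e)) = character V g - mat_trace (act V g * e)"
proof -
  note ec = cg_homD(1)[OF e(1)]
  show "1\<^sub>m (vdim V) - e \<in> ghom V V" by (rule hom_minus[OF V V id_hom[OF V] e(1)])
  have z: "e - e = 0\<^sub>m (vdim V) (vdim V)" using ec by (intro eq_matI) auto
  have "(1\<^sub>m (vdim V) - e) * (1\<^sub>m (vdim V) - e) = (1\<^sub>m (vdim V) - e) * 1\<^sub>m (vdim V) - (1\<^sub>m (vdim V) - e) * e"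
    by (rule mult_minus_distrib_mat) (use ec in auto)
  also have "(1\<^sub>m (vdim V) - e) * e = e - e"
    using ec by (subst minus_mult_distrib_mat[of _ "vdim V" "vdim V"]) (auto simp: e(2))
  also have "(1\<^sub>m (vdim V) - e) * 1\<^sub>m (vdim V) - (e - e) = 1\<^sub>m (vdim V) - e"
    unfolding z using ec by (intro eq_matI) auto
  finally show "(1\<^sub>m (vdim V) - e) * (1\<^sub>m (vdim V) - e) = 1\<^sub>m (vdim V) - e" .
  show "mat_trace (act V g * (1\<^sub>m (vdim V) - e)) = character V g - mat_trace (act V g * e)"
    if g: "g \<in> carrier G"
  proof -
    note c = act_carrier[OF V g]
    have "act V g * (1\<^sub>m (vdim V) - e) = act V g - act V g * e"
      using c ec by (subst mult_minus_distrib_mat[OF c, of _ "vdim V"]) auto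
    thus ?thesis using c ec by (simp add: character_def mat_trace_minus[of _ "vdim V"])
  qed
qed

text \<open>
  Here \<open>f\<close> and \<open>k\<close> are inverse to each other between the images of \<open>k f\<close> and \<open>f k\<close>, while \<open>f1\<close> and \<open>k1\<close>
  are inverse to each other between the images of \<open>1 - k f = C R\<close> and \<open>1 - f k = C' R'\<close>. The mixed terms
  of the product vanish because \<open>k C' = 0\<close> and \<open>R' f = 0\<close>.
\<close>

lemma glue_isomorphisms:
  fixes f k :: "complex mat"
  assumes f: "f \<in> carrier_mat m n" and k: "k \<in> carrier_mat n m" and kfk: "k * f * k = k"
    and C: "C \<in> carrier_mat n r" and R: "R \<in> carrier_mat r n" and CR: "1\<^sub>m n - k * f = C * R"
    and C': "C' \<in> carrier_mat m r'" and R': "R' \<in> carrier_mat r' m" and CR': "1\<^sub>m m - f * k = C' * R'"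
    and RC': "R' * C' = 1\<^sub>m r'"
    and f1: "f1 \<in> carrier_mat r' r" and k1: "k1 \<in> carrier_mat r r'" and inv: "k1 * f1 = 1\<^sub>m r"
    and fkf: "f * k * f = f"
  shows "(k + C * k1 * R') * (f + C' * f1 * R) = 1\<^sub>m n"
proof -
  have kC'R': "k * (C' * R') = 0\<^sub>m n m"
  proof -
    have "k * (C' * R') = k * 1\<^sub>m m - k * (f * k)"
      unfolding CR'[symmetric] using f k by (intro mult_minus_distrib_mat[of _ n m]) auto
    also have "k * (f * k) = k" using kfk f k by (simp add: mult_mat_assoc_dim)
    finally show ?thesis using k by (intro eq_matI) auto
  qed
  have C'R'f: "C' * R' * f = 0\<^sub>m m n"
  proof -
    have "C' * R' * f = 1\<^sub>m m * f - f * k * f"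
      unfolding CR'[symmetric] using f k by (intro minus_mult_distrib_mat[of _ m m]) auto
    thus ?thesis using f fkf by (intro eq_matI) auto
  qed
  have kC': "k * C' = 0\<^sub>m n r'"
  proof -
    have "k * C' = k * (C' * R') * C'" using k C' R' by (simp add: mult_mat_assoc_dim RC')
    thus ?thesis using C' by (simp add: kC'R')
  qed
  have R'f: "R' * f = 0\<^sub>m r' n"
  proof -
    have "R' * f = R' * (C' * R' * f)"
      using f C' R' by (simp add: mult_mat_assoc_dim cancel_inverse_mat[OF RC' R' C'])
    thus ?thesis using R' by (simp add: C'R'f)
  qed
  have 1: "k * (C' * f1 * R) = 0\<^sub>m n n"
  proof -
    have "k * (C' * f1 * R) = k * C' * (f1 * R)" using k C' f1 R by (simp add: mult_mat_assoc_dim)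
    thus ?thesis unfolding kC' using f1 R by simp
  qed
  have 2: "C * k1 * R' * f = 0\<^sub>m n n"
  proof -
    have "C * k1 * R' * f = C * k1 * (R' * f)" using f C k1 R' by (simp add: mult_mat_assoc_dim)
    thus ?thesis unfolding R'f using C k1 by simp
  qed
  have 3: "C * k1 * R' * (C' * f1 * R) = C * R"
    using C k1 R' C' f1 R
    by (simp add: mult_mat_assoc_dim cancel_inverse_mat[OF RC' R' C'] cancel_inverse_mat[OF inv k1 f1])
  have X: "C * k1 * R' \<in> carrier_mat n m" and Y: "C' * f1 * R \<in> carrier_mat m n"
    using C k1 R' C' f1 R by auto
  have "(k + C * k1 * R') * (f + C' * f1 * R) =
      k * (f + C' * f1 * R) + C * k1 * R' * (f + C' * f1 * R)"
    using f Y by (intro add_mult_distrib_mat[OF k X, of _ n]) simp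
  also have "\<dots> = k * f + k * (C' * f1 * R) + (C * k1 * R' * f + C * k1 * R' * (C' * f1 * R))"
    by (simp only: mult_add_distrib_mat[OF k f Y] mult_add_distrib_mat[OF X f Y])
  also have "\<dots> = k * f + C * R" unfolding 1 2 3 using f k C R by simp
  also have "\<dots> = 1\<^sub>m n" unfolding CR[symmetric] using f k by (intro eq_matI) auto
  finally show ?thesis .
qed

text \<open>
  A nonzero \<open>f : V \<rightarrow> W\<close> and its equivariant generalized inverse \<open>k\<close> give isomorphic summands of \<open>V\<close> and
  \<open>W\<close>, the images of \<open>k f\<close> and \<open>f k\<close>. Their complements again have equal characters and smaller
  dimension, so that induction provides an isomorphism between these.
\<close>

theorem equal_characters_inverse_homs:
  assumes "gmod V" "gmod W"
    and "\<And>g. g \<in> carrier G \<Longrightarrow> character V g = character W g"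
  shows "\<exists>f k. f \<in> ghom V W \<and> k \<in> ghom W V \<and> k * f = 1\<^sub>m (vdim V) \<and> f * k = 1\<^sub>m (vdim W)"
  using assms
proof (induction "vdim V" arbitrary: V W rule: less_induct)
  case less
  note V = less.prems(1) and W = less.prems(2) and eq = less.prems(3)
  have dims: "vdim V = vdim W"
    using eq[OF one_closed] by (simp add: character_one[OF V] character_one[OF W])
  show ?case
  proof (cases "vdim V = 0")
    case True
    have "0\<^sub>m (vdim W) (vdim V) \<in> ghom V W" "0\<^sub>m (vdim V) (vdim W) \<in> ghom W V"
      using dims True act_carrier[OF V, THEN carrier_matD(1)] act_carrier[OF V, THEN carrier_matD(2)]
        act_carrier[OF W, THEN carrier_matD(1)] act_carrier[OF W, THEN carrier_matD(2)]
      by (auto intro!: cg_homI eq_matI)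
    moreover have "0\<^sub>m (vdim V) (vdim W) * 0\<^sub>m (vdim W) (vdim V) = (1\<^sub>m (vdim V) :: complex mat)"
      "0\<^sub>m (vdim W) (vdim V) * 0\<^sub>m (vdim V) (vdim W) = (1\<^sub>m (vdim W) :: complex mat)"
      using dims True by (auto intro!: eq_matI)
    ultimately show ?thesis by blast
  next
    case False
    obtain f where f: "f \<in> ghom V W" and f0: "f \<noteq> 0\<^sub>m (vdim W) (vdim V)"
      using nonzero_hom_exists[OF V W False eq] by metis
    obtain k where k: "k \<in> ghom W V" and fkf: "f * k * f = f" and kfk: "k * f * k = k"
      using hom_generalized_inverse[OF V W f] by metis
    note fc = cg_homD(1)[OF f] and kc = cg_homD(1)[OF k]
    define e where "e = k * f"
    define e' where "e' = f * k"
    have e: "e \<in> ghom V V" unfolding e_def by (rule hom_comp[OF V W V k f])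
    have e': "e' \<in> ghom W W" unfolding e'_def by (rule hom_comp[OF W V W f k])
    have "e * e = (k * f * k) * f" unfolding e_def using fc kc by (simp add: mult_mat_assoc_dim)
    hence ee: "e * e = e" by (simp add: kfk e_def)
    have "e' * e' = (f * k * f) * k" unfolding e'_def using fc kc by (simp add: mult_mat_assoc_dim)
    hence ee': "e' * e' = e'" by (simp add: fkf e'_def)
    have tr_ee': "mat_trace (act V g * e) = mat_trace (act W g * e')" if g: "g \<in> carrier G" for g
    proof -
      note cV = act_carrier[OF V g] and cW = act_carrier[OF W g]
      have "mat_trace (act V g * e) = mat_trace (f * (act V g * k))"
        unfolding e_def using fc kc cV
        by (subst mat_trace_mult_comm[of f "vdim W" "vdim V"]) (auto simp: mult_mat_assoc_dim)
      also have "f * (act V g * k) = f * act V g * k" using fc kc cV by (simp add: mult_mat_assoc_dim)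
      also have "\<dots> = act W g * e'" unfolding e'_def using fc kc cW
        by (simp add: cg_homD(2)[OF f g] mult_mat_assoc_dim)
      finally show ?thesis .
    qed
    have "mat_trace e \<noteq> 0"
    proof
      assume "mat_trace e = 0"
      hence "e = 0\<^sub>m (vdim V) (vdim V)" by (rule idempotent_trace_zero[OF V e ee])
      hence "f * (k * f) = 0\<^sub>m (vdim W) (vdim V)" using fc by (simp add: e_def)
      moreover have "f * (k * f) = f" using fc kc fkf by (simp add: mult_mat_assoc_dim)
      ultimately show False using f0 by simp
    qed
    note u = idempotent_complement[OF V e ee] and u' = idempotent_complement[OF W e' ee']
    obtain V1 C R where V1: "gmod V1" and C: "C \<in> ghom V1 V" and R: "R \<in> ghom V V1"
      and CR: "1\<^sub>m (vdim V) - e = C * R" and RC: "R * C = 1\<^sub>m (vdim V1)"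
      and chi1: "\<And>g. g \<in> carrier G \<Longrightarrow> character V1 g = mat_trace (act V g * (1\<^sub>m (vdim V) - e))"
      and dim1: "of_nat (vdim V1) = mat_trace (1\<^sub>m (vdim V) - e)"
      using idempotent_summand[OF V u(1,2)] by metis
    obtain W1 C' R' where W1: "gmod W1" and C': "C' \<in> ghom W1 W" and R': "R' \<in> ghom W W1"
      and CR': "1\<^sub>m (vdim W) - e' = C' * R'" and RC': "R' * C' = 1\<^sub>m (vdim W1)"
      and chi1': "\<And>g. g \<in> carrier G \<Longrightarrow> character W1 g = mat_trace (act W g * (1\<^sub>m (vdim W) - e'))"
      using idempotent_summand[OF W u'(1,2)] by metis
    have eq1: "character V1 g = character W1 g" if g: "g \<in> carrier G" for g
      using chi1[OF g] chi1'[OF g] u(3)[OF g] u'(3)[OF g] tr_ee'[OF g] eq[OF g] by simp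
    obtain A :: "'a cmod" where A: "of_nat (vdim A) = mat_trace e" using idempotent_summand[OF V e ee] by metis
    hence A0: "vdim A \<noteq> 0" using \<open>mat_trace e \<noteq> 0\<close> by (metis of_nat_0)
    have "mat_trace (1\<^sub>m (vdim V) - e) = of_nat (vdim V) - mat_trace e"
      using cg_homD(1)[OF e] by (simp add: mat_trace_minus[of _ "vdim V"] mat_trace_one)
    hence "of_nat (vdim V1 + vdim A) = (of_nat (vdim V) :: complex)" using dim1 A by simp
    hence "vdim V1 + vdim A = vdim V" by (simp only: of_nat_eq_iff)
    hence "vdim V1 < vdim V" using A0 by simp
    from less.hyps[OF this V1 W1 eq1] obtain f1 k1 where f1: "f1 \<in> ghom V1 W1" and k1: "k1 \<in> ghom W1 V1"
      and kf1: "k1 * f1 = 1\<^sub>m (vdim V1)" and fk1: "f1 * k1 = 1\<^sub>m (vdim W1)" by blast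
    note cs = fc kc cg_homD(1)[OF C] cg_homD(1)[OF R] cg_homD(1)[OF C'] cg_homD(1)[OF R']
      cg_homD(1)[OF f1] cg_homD(1)[OF k1]
    have "f + C' * f1 * R \<in> ghom V W"
      by (intro hom_add hom_comp[of V V1 W _ R] hom_comp[of V1 W1 W C'] V W V1 W1 f C' f1 R)
    moreover have "k + C * k1 * R' \<in> ghom W V"
      by (intro hom_add hom_comp[of W W1 V _ R'] hom_comp[of W1 V1 V C] V W V1 W1 k C k1 R')
    moreover have "(k + C * k1 * R') * (f + C' * f1 * R) = 1\<^sub>m (vdim V)"
      by (rule glue_isomorphisms[OF cs(1,2) kfk cs(3,4) CR[unfolded e_def] cs(5,6) CR'[unfolded e'_def]
            RC' cs(7,8) kf1 fkf])
    moreover have "(f + C' * f1 * R) * (k + C * k1 * R') = 1\<^sub>m (vdim W)"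
      by (rule glue_isomorphisms[OF cs(2,1) fkf cs(5,6) CR'[unfolded e'_def] cs(3,4) CR[unfolded e_def]
            RC cs(8,7) fk1 kfk])
    ultimately show ?thesis by blast
  qed
qed

corollary equal_characters_iso:
  assumes V: "gmod V" and W: "gmod W"
    and eq: "\<And>g. g \<in> carrier G \<Longrightarrow> character V g = character W g"
  shows "cg_iso G V W"
proof -
  have dims: "vdim V = vdim W"
    using eq[OF one_closed] by (simp add: character_one[OF V] character_one[OF W])
  obtain f k where f: "f \<in> ghom V W" and k: "k \<in> ghom W V"
    and "k * f = 1\<^sub>m (vdim V)" "f * k = 1\<^sub>m (vdim W)"
    using equal_characters_inverse_homs[OF assms] by blast
  moreover from this have "invertible_mat f"
    using cg_homD(1)[OF f] cg_homD(1)[OF k] dims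
    by (auto simp: invertible_mat_def inverts_mat_def)
  ultimately show ?thesis
    unfolding cg_iso_def using dims cg_homD[OF f] by auto
qed

section \<open>Simple modules\<close>

lemma submodule_sum_closed:
  assumes V: "gmod V" and U: "cg_submodule G V U" and "finite S" "\<And>s. s \<in> S \<Longrightarrow> x s \<in> U"
  shows "vec (vdim V) (\<lambda>a. \<Sum>s\<in>S. c s * x s $ a) \<in> U"
  using assms(3,4)
proof (induction S rule: finite_induct)
  case empty
  have "vec (vdim V) (\<lambda>a. \<Sum>s\<in>{}. c s * x s $ a) = 0\<^sub>v (vdim V)" by (intro eq_vecI) auto
  moreover have "0\<^sub>v (vdim V) \<in> U" using U by (simp add: cg_submodule_def)
  ultimately show ?case by metis
next
  case (insert s S)
  have xs: "x s \<in> carrier_vec (vdim V)" "c s \<cdot>\<^sub>v x s \<in> U"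
    using insert.prems U by (auto simp: cg_submodule_def)
  have "vec (vdim V) (\<lambda>a. \<Sum>s\<in>insert s S. c s * x s $ a) =
      c s \<cdot>\<^sub>v x s + vec (vdim V) (\<lambda>a. \<Sum>s\<in>S. c s * x s $ a)"
    using insert.hyps xs by (intro eq_vecI) auto
  then show ?case using xs insert U by (auto simp: cg_submodule_def)
qed

lemma mat_trace_hom_avg:
  assumes V: "gmod V" and B: "B \<in> carrier_mat (vdim V) (vdim V)"
  shows "mat_trace (hom_avg V V B) = of_nat (order G) * mat_trace B"
proof -
  note cV = act_carrier[OF V]
  have "mat_trace (hom_avg V V B) = (\<Sum>g\<in>carrier G. mat_trace (act V g * B * act V (inv g)))"
    unfolding hom_avg_def by (rule mat_trace_sum[OF hom_avg_carrier[OF V V B]])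
  also have "\<dots> = (\<Sum>g\<in>carrier G. mat_trace B)"
  proof (intro sum.cong refl)
    fix g assume g: "g \<in> carrier G"
    have "mat_trace (act V g * B * act V (inv g)) = mat_trace (act V (inv g) * (act V g * B))"
      by (rule mat_trace_mult_comm) (use cV[OF g] cV[of "inv g"] g B in auto)
    also have "act V (inv g) * (act V g * B) = B"
      by (rule cancel_inverse_mat[OF act_inv'[OF V g]]) (use cV[OF g] cV[of "inv g"] g B in auto)
    finally show "mat_trace (act V g * B * act V (inv g)) = mat_trace B" .
  qed
  finally show ?thesis by (simp add: Coset.order_def)
qed

text \<open>
  If \<open>0 \<noteq> w \<in> U\<close> then averaging a matrix with image \<open>\<complex>w\<close> and nonzero trace gives a
  homomorphism into \<open>U\<close>; being a nonzero scalar, it is onto.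
\<close>

lemma simple_if_homs_scalar:
  assumes V: "gmod V" and dim: "vdim V \<noteq> 0"
    and scalar: "\<And>f. f \<in> ghom V V \<Longrightarrow> \<exists>c. f = c \<cdot>\<^sub>m 1\<^sub>m (vdim V)"
  shows "simple_cg_module G V"
  unfolding simple_cg_module_def
proof (intro conjI V dim allI impI)
  fix U assume U: "cg_submodule G V U"
  note cV = act_carrier[OF V]
  let ?n = "vdim V"
  have Uc: "U \<subseteq> carrier_vec ?n" using U by (simp add: cg_submodule_def)
  show "U = {0\<^sub>v ?n} \<or> U = carrier_vec ?n"
  proof (cases "U = {0\<^sub>v ?n}")
    case False
    then obtain w where w: "w \<in> U" "w \<noteq> 0\<^sub>v ?n" using U by (auto simp: cg_submodule_def)
    hence wc: "w \<in> carrier_vec ?n" using Uc by blast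
    then obtain i where i: "i < ?n" "w $ i \<noteq> 0" using w(2) by (metis eq_vecI carrier_vecD index_zero_vec)
    define B where "B = mat ?n ?n (\<lambda>(a, b). if b = i then w $ a else 0)"
    have B: "B \<in> carrier_mat ?n ?n" by (simp add: B_def)
    obtain c where c: "hom_avg V V B = c \<cdot>\<^sub>m 1\<^sub>m ?n" using scalar[OF hom_avg_hom[OF V V B]] by blast
    have "c * of_nat ?n = mat_trace (hom_avg V V B)"
      unfolding c by (simp add: mat_trace_smult[of _ ?n] mat_trace_one)
    also have "\<dots> = of_nat (order G) * mat_trace B" by (rule mat_trace_hom_avg[OF V B])
    also have "mat_trace B = w $ i" using i by (simp add: mat_trace_def B_def)
    also have "of_nat (order G) * w $ i \<noteq> 0" using i order_pos by simp
    finally have c0: "c \<noteq> 0" by auto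
    have "v \<in> U" if v: "v \<in> carrier_vec ?n" for v
    proof -
      define z where "z g = (act V (inv g) *\<^sub>v v) $ i" for g
      have "hom_avg V V B *\<^sub>v v = vec ?n (\<lambda>a. \<Sum>g\<in>carrier G. z g * (act V g *\<^sub>v w) $ a)"
      proof (rule eq_vecI)
        fix a assume "a < dim_vec (vec ?n (\<lambda>a. \<Sum>g\<in>carrier G. z g * (act V g *\<^sub>v w) $ a))"
        hence a: "a < ?n" by simp
        have AB: "(act V g * B) $$ (a, b) = (if b = i then (act V g *\<^sub>v w) $ a else 0)"
          if g: "g \<in> carrier G" and b: "b < ?n" for g b
        proof -
          have "(act V g * B) $$ (a, b) = (\<Sum>l<?n. act V g $$ (a, l) * B $$ (l, b))"
            by (rule index_mult_mat_sum[OF cV[OF g] B a b])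
          also have "\<dots> = (if b = i then \<Sum>l<?n. act V g $$ (a, l) * w $ l else 0)"
            using b by (auto simp: B_def)
          also have "(\<Sum>l<?n. act V g $$ (a, l) * w $ l) = (act V g *\<^sub>v w) $ a"
            using a wc cV[OF g] by (auto simp: scalar_prod_def atLeast0LessThan intro!: sum.cong)
          finally show ?thesis .
        qed
        have entry: "(act V g * B * act V (inv g)) $$ (a, l) = (act V g *\<^sub>v w) $ a * act V (inv g) $$ (i, l)"
          if g: "g \<in> carrier G" and l: "l < ?n" for g l
        proof -
          have "(act V g * B * act V (inv g)) $$ (a, l) = (\<Sum>b<?n. (act V g * B) $$ (a, b) * act V (inv g) $$ (b, l))"
            by (rule index_mult_mat_sum[OF mult_carrier_mat[OF cV[OF g] B] cV a l]) (use g in simp)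
          also have "\<dots> = (\<Sum>b<?n. if b = i then (act V g *\<^sub>v w) $ a * act V (inv g) $$ (i, l) else 0)"
            by (intro sum.cong refl) (simp add: AB[OF g])
          finally show ?thesis using i by simp
        qed
        have "(hom_avg V V B *\<^sub>v v) $ a = (\<Sum>l<?n. hom_avg V V B $$ (a, l) * v $ l)"
          using a v by (auto simp: hom_avg_def mat_sum_def scalar_prod_def atLeast0LessThan intro!: sum.cong)
        also have "\<dots> = (\<Sum>l<?n. \<Sum>g\<in>carrier G. (act V g *\<^sub>v w) $ a * (act V (inv g) $$ (i, l) * v $ l))"
          using a by (intro sum.cong refl) (simp add: hom_avg_def mat_sum_def entry sum_distrib_right mult.assoc)
        also have "\<dots> = (\<Sum>g\<in>carrier G. (act V g *\<^sub>v w) $ a * (\<Sum>l<?n. act V (inv g) $$ (i, l) * v $ l))"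
          by (subst sum.swap) (simp add: sum_distrib_left)
        also have "\<dots> = (\<Sum>g\<in>carrier G. z g * (act V g *\<^sub>v w) $ a)"
        proof (intro sum.cong refl)
          fix g assume g: "g \<in> carrier G"
          have "(\<Sum>l<?n. act V (inv g) $$ (i, l) * v $ l) = z g"
            unfolding z_def using i v cV[of "inv g"] g
            by (auto simp: scalar_prod_def atLeast0LessThan intro!: sum.cong)
          thus "(act V g *\<^sub>v w) $ a * (\<Sum>l<?n. act V (inv g) $$ (i, l) * v $ l) = z g * (act V g *\<^sub>v w) $ a"
            by simp
        qed
        finally show "(hom_avg V V B *\<^sub>v v) $ a =
            vec ?n (\<lambda>a. \<Sum>g\<in>carrier G. z g * (act V g *\<^sub>v w) $ a) $ a" using a by simp
      qed (simp add: hom_avg_def mat_sum_def)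
      also have "\<dots> \<in> U"
        by (rule submodule_sum_closed[OF V U fin_carrier]) (use U w in \<open>auto simp: cg_submodule_def\<close>)
      finally have "(1 / c) \<cdot>\<^sub>v (hom_avg V V B *\<^sub>v v) \<in> U" using U by (auto simp: cg_submodule_def)
      moreover have "(1 / c) \<cdot>\<^sub>v (hom_avg V V B *\<^sub>v v) = v"
        unfolding c using v c0 by (intro eq_vecI) auto
      ultimately show ?thesis by simp
    qed
    thus ?thesis using Uc by blast
  qed simp
qed

text \<open>
  Schur's lemma: the eigenspace of \<open>f\<close> for some eigenvalue is a nonzero submodule, hence everything.
\<close>

lemma schur_scalar:
  assumes M: "simple_cg_module G M" and f: "f \<in> ghom M M"
  shows "\<exists>c. f = c \<cdot>\<^sub>m 1\<^sub>m (vdim M)"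
proof -
  have gM: "gmod M" and dim: "vdim M \<noteq> 0"
    and simple: "\<And>W. cg_submodule G M W \<Longrightarrow> W = {0\<^sub>v (vdim M)} \<or> W = carrier_vec (vdim M)"
    using M by (auto simp: simple_cg_module_def)
  note fc = cg_homD(1)[OF f]
  obtain c where "eigenvalue f c"
    using spectrum_non_empty[OF fc] dim by (auto simp: spectrum_def)
  then obtain v where v: "v \<in> carrier_vec (vdim M)" "v \<noteq> 0\<^sub>v (vdim M)" "f *\<^sub>v v = c \<cdot>\<^sub>v v"
    using fc by (auto simp: eigenvalue_def eigenvector_def)
  define W where "W = {v \<in> carrier_vec (vdim M). f *\<^sub>v v = c \<cdot>\<^sub>v v}"
  have "cg_submodule G M W"
    unfolding cg_submodule_def
  proof (intro conjI ballI allI)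
    show "0\<^sub>v (vdim M) \<in> W" using fc by (auto simp: W_def)
    show "v + w \<in> W" if "v \<in> W" "w \<in> W" for v w
      using that fc by (auto simp: W_def mult_add_distrib_mat_vec[OF fc] smult_add_distrib_vec[of _ "vdim M"])
    show "a \<cdot>\<^sub>v v \<in> W" if "v \<in> W" for a v
      using that fc by (auto simp: W_def mult_mat_vec[OF fc] smult_smult_assoc mult.commute)
    show "act M g *\<^sub>v v \<in> W" if g: "g \<in> carrier G" and v: "v \<in> W" for g v
    proof -
      note c = act_carrier[OF gM g]
      have "f *\<^sub>v (act M g *\<^sub>v v) = (f * act M g) *\<^sub>v v"
        by (rule assoc_mult_mat_vec[symmetric]) (use fc c v in \<open>auto simp: W_def\<close>)
      also have "\<dots> = act M g *\<^sub>v (f *\<^sub>v v)"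
        unfolding cg_homD(2)[OF f g] by (rule assoc_mult_mat_vec) (use fc c v in \<open>auto simp: W_def\<close>)
      also have "\<dots> = c \<cdot>\<^sub>v (act M g *\<^sub>v v)"
        using v c by (simp add: W_def mult_mat_vec[OF c])
      finally show ?thesis using c v by (auto simp: W_def)
    qed
  qed (auto simp: W_def)
  from simple[OF this] v have "W = carrier_vec (vdim M)" unfolding W_def by blast
  hence all: "f *\<^sub>v v = c \<cdot>\<^sub>v v" if "v \<in> carrier_vec (vdim M)" for v using that unfolding W_def by blast
  have "f = c \<cdot>\<^sub>m 1\<^sub>m (vdim M)"
  proof (rule eq_matI)
    fix i j assume "i < dim_row (c \<cdot>\<^sub>m 1\<^sub>m (vdim M))" "j < dim_col (c \<cdot>\<^sub>m 1\<^sub>m (vdim M))"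
    hence ij: "i < vdim M" "j < vdim M" by auto
    have "f $$ (i, j) = (f *\<^sub>v unit_vec (vdim M) j) $ i" using ij fc by (simp add: scalar_prod_right_unit)
    also have "\<dots> = (c \<cdot>\<^sub>m 1\<^sub>m (vdim M)) $$ (i, j)" using ij by (simp add: all)
    finally show "f $$ (i, j) = (c \<cdot>\<^sub>m 1\<^sub>m (vdim M)) $$ (i, j)" .
  qed (use fc in auto)
  thus ?thesis ..
qed

text \<open>
  A module that is not simple has a non-scalar endomorphism; subtracting an eigenvalue makes it
  singular but not zero, and Maschke's averaging turns it into an idempotent other than \<open>0\<close>, \<open>1\<close>.
\<close>

lemma non_simple_summands:
  assumes V: "gmod V" and dim: "vdim V \<noteq> 0" and ns: "\<not> simple_cg_module G V"
  obtains A B where "gmod A" "gmod B" "vdim A < vdim V" "vdim B < vdim V"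
    "\<And>g. g \<in> carrier G \<Longrightarrow> character V g = character A g + character B g"
proof -
  let ?n = "vdim V" and ?I = "1\<^sub>m (vdim V) :: complex mat"
  obtain f0 where f0: "f0 \<in> ghom V V" and nscal: "\<And>c. f0 \<noteq> c \<cdot>\<^sub>m ?I"
    using simple_if_homs_scalar[OF V dim] ns by blast
  note f0c = cg_homD(1)[OF f0]
  obtain c where "eigenvalue f0 c"
    using spectrum_non_empty[OF f0c] dim by (auto simp: spectrum_def)
  then obtain v where v: "v \<in> carrier_vec ?n" "v \<noteq> 0\<^sub>v ?n" "f0 *\<^sub>v v = c \<cdot>\<^sub>v v"
    using f0c by (auto simp: eigenvalue_def eigenvector_def)
  define f where "f = f0 - c \<cdot>\<^sub>m ?I"
  have f: "f \<in> ghom V V" unfolding f_def by (intro hom_minus hom_smult id_hom V f0)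
  note fc = cg_homD(1)[OF f]
  have f_nz: "f \<noteq> 0\<^sub>m ?n ?n"
  proof
    assume "f = 0\<^sub>m ?n ?n"
    hence "f $$ (i, j) = 0" if "i < ?n" "j < ?n" for i j using that by simp
    hence "f0 = c \<cdot>\<^sub>m ?I" using f0c by (intro eq_matI) (auto simp: f_def)
    thus False using nscal by blast
  qed
  have fv: "f *\<^sub>v v = 0\<^sub>v ?n"
  proof -
    have "f *\<^sub>v v = f0 *\<^sub>v v - (c \<cdot>\<^sub>m ?I) *\<^sub>v v"
      unfolding f_def by (rule minus_mult_distrib_mat_vec[OF f0c _ v(1)]) simp
    also have "(c \<cdot>\<^sub>m ?I) *\<^sub>v v = c \<cdot>\<^sub>v v" using v(1) by (intro eq_vecI) auto
    finally show ?thesis using v by (auto intro!: eq_vecI)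
  qed
  obtain k where k: "k \<in> ghom V V" and fkf: "f * k * f = f" and kfk: "k * f * k = k"
    using hom_generalized_inverse[OF V V f] by metis
  note kc = cg_homD(1)[OF k]
  define e where "e = k * f"
  have e: "e \<in> ghom V V" unfolding e_def by (rule hom_comp[OF V V V k f])
  note ec = cg_homD(1)[OF e]
  have "e * e = (k * f * k) * f" unfolding e_def using fc kc by (simp add: mult_mat_assoc_dim)
  hence ee: "e * e = e" by (simp add: kfk e_def)
  note u = idempotent_complement[OF V e ee]
  have "e \<noteq> 0\<^sub>m ?n ?n"
  proof
    assume "e = 0\<^sub>m ?n ?n"
    hence "f * (k * f) = 0\<^sub>m ?n ?n" using fc by (simp add: e_def)
    moreover have "f * (k * f) = f" using fc kc fkf by (simp add: mult_mat_assoc_dim)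
    ultimately show False using f_nz by simp
  qed
  hence tr1: "mat_trace e \<noteq> 0" using idempotent_trace_zero[OF V e ee] by blast
  have "?I - e \<noteq> 0\<^sub>m ?n ?n"
  proof
    assume z: "?I - e = 0\<^sub>m ?n ?n"
    have 1: "(?I - e) *\<^sub>v v = v - e *\<^sub>v v"
      using v(1) by (subst minus_mult_distrib_mat_vec[OF _ ec v(1)]) auto
    have "e *\<^sub>v v = k *\<^sub>v (f *\<^sub>v v)" unfolding e_def by (rule assoc_mult_mat_vec[OF kc fc v(1)])
    moreover have "k *\<^sub>v 0\<^sub>v ?n = 0\<^sub>v ?n" using kc by (intro eq_vecI) auto
    ultimately have "e *\<^sub>v v = 0\<^sub>v ?n" by (simp add: fv)
    hence "v = (?I - e) *\<^sub>v v" unfolding 1 using v(1) by (intro eq_vecI) auto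
    also have "\<dots> = 0\<^sub>v ?n" unfolding z using v(1) by (intro eq_vecI) auto
    finally show False using v(2) by blast
  qed
  hence tr2: "mat_trace (?I - e) \<noteq> 0" using idempotent_trace_zero[OF V u(1,2)] by blast
  obtain A where A: "gmod A" "\<And>g. g \<in> carrier G \<Longrightarrow> character A g = mat_trace (act V g * e)"
    "of_nat (vdim A) = mat_trace e"
    using idempotent_summand[OF V e ee] by metis
  obtain B where B: "gmod B" "\<And>g. g \<in> carrier G \<Longrightarrow> character B g = mat_trace (act V g * (?I - e))"
    "of_nat (vdim B) = mat_trace (?I - e)"
    using idempotent_summand[OF V u(1,2)] by metis
  have chi: "character V g = character A g + character B g" if "g \<in> carrier G" for g
    using A(2)[OF that] B(2)[OF that] u(3)[OF that] by simp
  have "vdim A \<noteq> 0" "vdim B \<noteq> 0" using A(3) B(3) tr1 tr2 by (metis of_nat_0)+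
  moreover have "of_nat (vdim V) = (of_nat (vdim A + vdim B) :: complex)"
    using chi[OF one_closed] by (simp add: character_one V A(1) B(1))
  hence "vdim V = vdim A + vdim B" by (simp only: of_nat_eq_iff)
  ultimately show ?thesis using that[OF A(1) B(1)] chi by simp
qed

lemma character_sum_of_simple:
  assumes "gmod V"
  shows "\<exists>Ss. (\<forall>S\<in>set Ss. simple_cg_module G S) \<and>
    (\<forall>g\<in>carrier G. character V g = (\<Sum>S\<leftarrow>Ss. character S g))"
  using assms
proof (induction "vdim V" arbitrary: V rule: less_induct)
  case less
  note V = less.prems
  consider "vdim V = 0" | "simple_cg_module G V" | "vdim V \<noteq> 0" "\<not> simple_cg_module G V" by blast
  then show ?case
  proof cases
    case 1
    have "character V g = 0" if "g \<in> carrier G" for g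
      using act_carrier[OF V that] 1 by (simp add: character_def mat_trace_def)
    thus ?thesis by (intro exI[of _ "[]"]) simp
  next
    case 2
    thus ?thesis by (intro exI[of _ "[V]"]) simp
  next
    case 3
    obtain A B where A: "gmod A" "vdim A < vdim V" and B: "gmod B" "vdim B < vdim V"
      and chi: "\<And>g. g \<in> carrier G \<Longrightarrow> character V g = character A g + character B g"
      using non_simple_summands[OF V 3] by metis
    from less.hyps[OF A(2,1)] obtain As where As: "\<forall>S\<in>set As. simple_cg_module G S"
      "\<forall>g\<in>carrier G. character A g = (\<Sum>S\<leftarrow>As. character S g)" by blast
    from less.hyps[OF B(2,1)] obtain Bs where Bs: "\<forall>S\<in>set Bs. simple_cg_module G S"
      "\<forall>g\<in>carrier G. character B g = (\<Sum>S\<leftarrow>Bs. character S g)" by blast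
    show ?thesis using As Bs chi by (intro exI[of _ "As @ Bs"]) auto
  qed
qed


section \<open>Convolution of irreducible characters\<close>

text \<open>
  Averaging a unit matrix gives a scalar by Schur's lemma, and comparing traces determines it.
\<close>

lemma schur_orthogonality:
  assumes M: "simple_cg_module G M"
    and k: "k < vdim M" and i: "i < vdim M" and j: "j < vdim M" and l: "l < vdim M"
  shows "(\<Sum>g\<in>carrier G. act M g $$ (k, i) * act M (inv g) $$ (j, l)) =
    (if k = l \<and> i = j then of_nat (order G) / of_nat (vdim M) else 0)"
proof -
  have gM: "gmod M" and d: "vdim M \<noteq> 0" using M by (auto simp: simple_cg_module_def)
  let ?E = "unit_mat (vdim M) (vdim M) i j"
  obtain c where c: "hom_avg M M ?E = c \<cdot>\<^sub>m 1\<^sub>m (vdim M)"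
    using schur_scalar[OF M hom_avg_hom[OF gM gM unit_mat_carrier]] by blast
  have "c * of_nat (vdim M) = of_nat (order G) * mat_trace ?E"
    using mat_trace_hom_avg[OF gM unit_mat_carrier, of i j] unfolding c
    by (simp add: mat_trace_smult[of _ "vdim M"] mat_trace_one)
  moreover have "mat_trace ?E = (\<Sum>a<vdim M. if a = i then if i = j then 1 else 0 else 0)"
    unfolding mat_trace_def by (intro sum.cong) (auto simp: unit_mat_def)
  ultimately have "c = (if i = j then of_nat (order G) / of_nat (vdim M) else 0)"
    using d i by (auto simp: field_simps split: if_splits)
  moreover have "(\<Sum>g\<in>carrier G. act M g $$ (k, i) * act M (inv g) $$ (j, l)) = (if k = l then c else 0)"
    using hom_avg_unit_entry[OF gM gM k i j l] k l unfolding c by (cases "k = l") simp_all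
  ultimately show ?thesis by simp
qed

text \<open>
  In other words \<open>(d / |G|) \<chi>\<close> is idempotent for convolution: expand both characters into matrix
  coefficients and apply the orthogonality relations.
\<close>

lemma character_convolution:
  assumes M: "simple_cg_module G M" and y: "y \<in> carrier G"
  shows "(\<Sum>g\<in>carrier G. character M g * character M (inv g \<otimes> y)) =
    of_nat (order G) / of_nat (vdim M) * character M y"
proof -
  have gM: "gmod M" using M by (auto simp: simple_cg_module_def)
  let ?n = "vdim M" and ?c = "of_nat (order G) / of_nat (vdim M) :: complex"
  note cM = act_carrier[OF gM]
  have "(\<Sum>g\<in>carrier G. character M g * character M (inv g \<otimes> y)) =
      (\<Sum>g\<in>carrier G. \<Sum>k<?n. \<Sum>j<?n. \<Sum>l<?n.
        act M y $$ (l, j) * (act M g $$ (k, k) * act M (inv g) $$ (j, l)))"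
  proof (intro sum.cong refl)
    fix g assume g: "g \<in> carrier G"
    have "character M (inv g \<otimes> y) = (\<Sum>j<?n. (act M (inv g) * act M y) $$ (j, j))"
      using g y cM[of "inv g"] by (simp add: character_def mat_trace_def act_mult[OF gM])
    also have "\<dots> = (\<Sum>j<?n. \<Sum>l<?n. act M (inv g) $$ (j, l) * act M y $$ (l, j))"
      using g y cM[of "inv g"] cM[of y]
      by (intro sum.cong refl index_mult_mat_sum[of _ ?n ?n _ ?n]) auto
    finally have chi: "character M (inv g \<otimes> y) = \<dots>" .
    have "character M g = (\<Sum>k<?n. act M g $$ (k, k))"
      using cM[OF g] by (simp add: character_def mat_trace_def)
    hence "character M g * character M (inv g \<otimes> y) = (\<Sum>k<?n. act M g $$ (k, k)) *
        (\<Sum>j<?n. \<Sum>l<?n. act M (inv g) $$ (j, l) * act M y $$ (l, j))" by (simp only: chi)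
    also have "\<dots> = (\<Sum>k<?n. \<Sum>j<?n. \<Sum>l<?n.
        act M y $$ (l, j) * (act M g $$ (k, k) * act M (inv g) $$ (j, l)))"
      unfolding sum_distrib_right
      by (intro sum.cong refl) (simp add: sum_distrib_left mult_ac)
    finally show "character M g * character M (inv g \<otimes> y) = (\<Sum>k<?n. \<Sum>j<?n. \<Sum>l<?n.
        act M y $$ (l, j) * (act M g $$ (k, k) * act M (inv g) $$ (j, l)))" .
  qed
  also have "\<dots> = (\<Sum>k<?n. \<Sum>j<?n. \<Sum>l<?n. act M y $$ (l, j) *
      (\<Sum>g\<in>carrier G. act M g $$ (k, k) * act M (inv g) $$ (j, l)))"
    by (simp add: sum_distrib_left sum.swap[of _ _ "carrier G"])
  also have "\<dots> = (\<Sum>k<?n. \<Sum>j<?n. \<Sum>l<?n. if l = k then if j = k then ?c * act M y $$ (k, k) else 0 else 0)"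
    by (intro sum.cong refl) (simp add: schur_orthogonality[OF M])
  also have "\<dots> = (\<Sum>k<?n. ?c * act M y $$ (k, k))"
    by (intro sum.cong refl) (simp add: sum.delta')
  also have "\<dots> = ?c * character M y"
    using cM[OF y] by (simp add: character_def mat_trace_def sum_distrib_left)
  finally show ?thesis .
qed

definition list_prod :: "'a list \<Rightarrow> 'a" where
  "list_prod xs = foldr (\<otimes>) xs \<one>"

lemma list_prod_simps [simp]: "list_prod [] = \<one>" "list_prod (x # xs) = x \<otimes> list_prod xs"
  by (auto simp: list_prod_def)

lemma list_prod_closed [simp]: "set xs \<subseteq> carrier G \<Longrightarrow> list_prod xs \<in> carrier G"
  by (induction xs) auto

lemma list_prod_append:
  "set xs \<subseteq> carrier G \<Longrightarrow> set ys \<subseteq> carrier G \<Longrightarrow> list_prod (xs @ ys) = list_prod xs \<otimes> list_prod ys"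
  by (induction xs) (auto simp: m_assoc)

lemma list_prod_concat_replicate:
  "set xs \<subseteq> carrier G \<Longrightarrow> list_prod (concat (replicate m xs)) = list_prod xs [^] m"
proof (induction m)
  case (Suc m)
  have "set (concat (replicate m xs)) \<subseteq> carrier G" using Suc.prems by (induction m) auto
  thus ?case using Suc nat_pow_Suc2[of "list_prod xs" m] by (simp add: list_prod_append)
qed simp

definition factorizations :: "nat \<Rightarrow> 'a \<Rightarrow> 'a list set" where
  "factorizations L y = {xs. length xs = L \<and> set xs \<subseteq> carrier G \<and> list_prod xs = y}"

lemma finite_factorizations: "finite (factorizations L y)"
  by (rule finite_subset[OF _ finite_lists_length_eq[OF fin_carrier, of L]])
    (auto simp: factorizations_def)

lemma character_iterated_convolution:
  assumes M: "simple_cg_module G M" and y: "y \<in> carrier G"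
  shows "(\<Sum>xs\<in>factorizations (Suc L) y. \<Prod>x\<leftarrow>xs. character M x) =
    (of_nat (order G) / of_nat (vdim M)) ^ L * character M y"
  using y
proof (induction L arbitrary: y)
  case 0
  have "factorizations (Suc 0) y = {[y]}"
    using 0 by (auto simp: factorizations_def length_Suc_conv)
  thus ?case by simp
next
  case (Suc L)
  let ?c = "of_nat (order G) / of_nat (vdim M) :: complex"
  have "bij_betw (\<lambda>(g, xs). g # xs) (SIGMA g:carrier G. factorizations (Suc L) (inv g \<otimes> y))
      (factorizations (Suc (Suc L)) y)"
  proof (rule bij_betwI[where g = "\<lambda>xs. (hd xs, tl xs)"])
    show "(\<lambda>(g, xs). g # xs) \<in> (SIGMA g:carrier G. factorizations (Suc L) (inv g \<otimes> y)) \<rightarrow>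
        factorizations (Suc (Suc L)) y"
      using Suc.prems by (auto simp: factorizations_def m_assoc[symmetric])
    show "(\<lambda>xs. (hd xs, tl xs)) \<in> factorizations (Suc (Suc L)) y \<rightarrow>
        (SIGMA g:carrier G. factorizations (Suc L) (inv g \<otimes> y))"
    proof
      fix xs assume xs: "xs \<in> factorizations (Suc (Suc L)) y"
      then obtain g ys where [simp]: "xs = g # ys" by (cases xs) (auto simp: factorizations_def)
      show "(hd xs, tl xs) \<in> (SIGMA g:carrier G. factorizations (Suc L) (inv g \<otimes> y))"
        using xs by (auto simp: factorizations_def m_assoc[symmetric])
    qed
  qed (auto simp: factorizations_def length_Suc_conv)
  hence "(\<Sum>xs\<in>factorizations (Suc (Suc L)) y. \<Prod>x\<leftarrow>xs. character M x) =
      (\<Sum>(g, xs)\<in>(SIGMA g:carrier G. factorizations (Suc L) (inv g \<otimes> y)).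
        character M g * (\<Prod>x\<leftarrow>xs. character M x))"
    by (subst sum.reindex_bij_betw[symmetric]) (auto simp: case_prod_unfold)
  also have "\<dots> = (\<Sum>g\<in>carrier G. \<Sum>xs\<in>factorizations (Suc L) (inv g \<otimes> y).
      character M g * (\<Prod>x\<leftarrow>xs. character M x))"
    by (subst sum.Sigma) (auto simp: finite_factorizations)
  also have "\<dots> = (\<Sum>g\<in>carrier G. character M g * (?c ^ L * character M (inv g \<otimes> y)))"
    using Suc by (intro sum.cong refl) (simp add: sum_distrib_left[symmetric])
  also have "\<dots> = ?c ^ L * (\<Sum>g\<in>carrier G. character M g * character M (inv g \<otimes> y))"
    by (simp add: sum_distrib_left mult_ac)
  also have "\<dots> = ?c ^ Suc L * character M y"
    by (simp add: character_convolution[OF M Suc.prems])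
  finally show ?case .
qed

end

section \<open>Integer combinations of roots of unity\<close>

definition int_span :: "complex set \<Rightarrow> complex set" where
  "int_span S = {\<Sum>s\<in>S. of_int (c s) * s |c. True}"

lemma int_spanI: "z = (\<Sum>s\<in>S. of_int (c s) * s) \<Longrightarrow> z \<in> int_span S"
  by (auto simp: int_span_def)

lemma int_span_zero: "0 \<in> int_span S"
  by (rule int_spanI[where c = "\<lambda>_. 0"]) simp

lemma int_span_base: "finite S \<Longrightarrow> s \<in> S \<Longrightarrow> s \<in> int_span S"
  by (rule int_spanI[where c = "\<lambda>x. if x = s then 1 else 0"])
    (simp add: if_distrib[of of_int] if_distrib[of "\<lambda>x. x * _"] cong: if_cong)

lemma int_span_add:
  assumes "a \<in> int_span S" "b \<in> int_span S"
  shows "a + b \<in> int_span S"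
proof -
  from assms obtain c d where "a = (\<Sum>s\<in>S. of_int (c s) * s)" "b = (\<Sum>s\<in>S. of_int (d s) * s)"
    by (auto simp: int_span_def)
  thus ?thesis by (intro int_spanI[where c = "\<lambda>s. c s + d s"]) (simp add: sum.distrib algebra_simps)
qed

lemma int_span_scale:
  assumes "a \<in> int_span S"
  shows "of_int m * a \<in> int_span S"
proof -
  from assms obtain c where "a = (\<Sum>s\<in>S. of_int (c s) * s)" by (auto simp: int_span_def)
  thus ?thesis by (intro int_spanI[where c = "\<lambda>s. m * c s"]) (simp add: sum_distrib_left mult.assoc)
qed

lemma int_span_sum: "(\<And>i. i \<in> I \<Longrightarrow> f i \<in> int_span S) \<Longrightarrow> sum f I \<in> int_span S"
  by (induction I rule: infinite_finite_induct) (auto intro: int_span_zero int_span_add)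

lemma int_span_mult:
  assumes S: "finite S" and closed: "\<And>s t. s \<in> S \<Longrightarrow> t \<in> S \<Longrightarrow> s * t \<in> S"
    and "a \<in> int_span S" "b \<in> int_span S"
  shows "a * b \<in> int_span S"
proof -
  from assms obtain c d where "a = (\<Sum>s\<in>S. of_int (c s) * s)" "b = (\<Sum>s\<in>S. of_int (d s) * s)"
    by (auto simp: int_span_def)
  hence "a * b = (\<Sum>s\<in>S. \<Sum>t\<in>S. of_int (c s * d t) * (s * t))"
    by (simp add: sum_product mult_ac)
  also have "\<dots> \<in> int_span S"
    by (intro int_span_sum int_span_scale int_span_base S closed)
  finally show ?thesis .
qed

lemma int_span_prod_list:
  assumes S: "finite S" "1 \<in> S" and closed: "\<And>s t. s \<in> S \<Longrightarrow> t \<in> S \<Longrightarrow> s * t \<in> S"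
    and "\<And>x. x \<in> set xs \<Longrightarrow> f x \<in> int_span S"
  shows "(\<Prod>x\<leftarrow>xs. f x) \<in> int_span S"
  using assms(4)
  by (induction xs) (auto intro: int_span_base[OF S] int_span_mult[OF S(1) closed])

text \<open>
  A maximal subset that is independent over the integers: each further element of \<open>S\<close> has a nonzero
  multiple in the span of \<open>T\<close>, and \<open>N\<close> is the product of the factors needed.
\<close>

lemma independent_subset_exists:
  assumes "finite (S :: complex set)"
  shows "\<exists>T\<subseteq>S. (\<forall>c. (\<Sum>t\<in>T. of_int (c t) * t) = 0 \<longrightarrow> (\<forall>t\<in>T. c t = (0::int))) \<and>
    (\<exists>N. N \<noteq> 0 \<and> (\<forall>s\<in>S. of_int N * s \<in> int_span T))"
  using assms
proof (induction S rule: finite_induct)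
  case empty
  then show ?case by (auto intro!: exI[of _ 1])
next
  case (insert s S)
  then obtain T N where T: "T \<subseteq> S" and N: "N \<noteq> 0" "\<And>s. s \<in> S \<Longrightarrow> of_int N * s \<in> int_span T"
    and indep: "\<And>c. (\<Sum>t\<in>T. of_int (c t) * t) = 0 \<Longrightarrow> \<forall>t\<in>T. c t = (0::int)" by blast
  have fT: "finite T" using T insert.hyps finite_subset by blast
  have sT: "s \<notin> T" using T insert.hyps by blast
  show ?case
  proof (cases "\<exists>m. m \<noteq> (0::int) \<and> of_int m * s \<in> int_span T")
    case True
    then obtain m where m: "m \<noteq> 0" "of_int m * s \<in> int_span T" by blast
    have "of_int (N * m) * x \<in> int_span T" if "x \<in> insert s S" for x
    proof (cases "x = s")
      case True
      thus ?thesis using int_span_scale[OF m(2), of N] by (simp add: mult_ac)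
    next
      case False
      thus ?thesis using int_span_scale[OF N(2), of x m] that by (simp add: mult_ac)
    qed
    thus ?thesis using T indep N(1) m(1) by (intro exI[of _ T] conjI exI[of _ "N * m"]) auto
  next
    case False
    have "\<forall>t\<in>insert s T. c t = 0" if c: "(\<Sum>t\<in>insert s T. of_int (c t) * t) = 0" for c
    proof -
      have "of_int (c s) * s + (\<Sum>t\<in>T. of_int (c t) * t) = 0" using c fT sT by simp
      hence "of_int (c s) * s = (\<Sum>t\<in>T. of_int (- c t) * t)"
        by (simp add: sum_negf eq_neg_iff_add_eq_0)
      hence "of_int (c s) * s \<in> int_span T" by (rule int_spanI)
      hence "c s = 0" using False by blast
      moreover from this have "\<forall>t\<in>T. c t = 0" using c fT sT by (intro indep) simp
      ultimately show ?thesis by blast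
    qed
    moreover have "of_int N * x \<in> int_span (insert s T)" if x: "x \<in> insert s S" for x
    proof (cases "x = s")
      case True
      thus ?thesis using fT by (intro int_span_scale int_span_base) auto
    next
      case False
      then obtain c where "of_int N * x = (\<Sum>t\<in>T. of_int (c t) * t)"
        using N(2)[of x] x False by (auto simp: int_span_def)
      hence "of_int N * x = (\<Sum>t\<in>insert s T. of_int (if t = s then 0 else c t) * t)"
        using fT sT by (auto intro!: sum.cong)
      thus ?thesis by (rule int_spanI)
    qed
    ultimately show ?thesis using T N(1) by (intro exI[of _ "insert s T"] conjI exI[of _ N]) auto
  qed
qed

text \<open>
  In coordinates with respect to a maximal independent subset of \<open>S\<close>, which express a fixed
  multiple of each element of the span, a number divisible by all powers of \<open>q\<close> has coordinates
  divisible by all powers of \<open>q\<close>.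
\<close>

lemma int_span_infinitely_divisible:
  assumes S: "finite S" and q: "q > (1::nat)"
    and div: "\<And>k. \<exists>b\<in>int_span S. \<beta> = of_nat (q ^ k) * b"
  shows "\<beta> = 0"
proof -
  obtain T N where T: "T \<subseteq> S" and N: "N \<noteq> 0" "\<And>s. s \<in> S \<Longrightarrow> of_int N * s \<in> int_span T"
    and indep: "\<And>c. (\<Sum>t\<in>T. of_int (c t) * t) = 0 \<Longrightarrow> \<forall>t\<in>T. c t = (0::int)"
    using independent_subset_exists[OF S] by blast
  have "\<exists>c. of_int N * \<beta> = of_nat (q ^ k) * (\<Sum>t\<in>T. of_int (c t) * t)" for k
  proof -
    obtain b where b: "b \<in> int_span S" "\<beta> = of_nat (q ^ k) * b" using div by blast
    then obtain c where c: "b = (\<Sum>s\<in>S. of_int (c s) * s)" by (auto simp: int_span_def)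
    have "of_int N * b = (\<Sum>s\<in>S. of_int (c s) * (of_int N * s))"
      unfolding c by (simp add: sum_distrib_left mult_ac)
    also have "\<dots> \<in> int_span T" by (intro int_span_sum int_span_scale N)
    finally obtain d where "of_int N * b = (\<Sum>t\<in>T. of_int (d t) * t)" by (auto simp: int_span_def)
    moreover have "of_int N * \<beta> = of_nat (q ^ k) * (of_int N * b)" by (simp add: b)
    ultimately show ?thesis by auto
  qed
  then obtain c where c: "\<And>k. of_int N * \<beta> = of_nat (q ^ k) * (\<Sum>t\<in>T. of_int (c k t) * t)" by metis
  have "c 0 t = 0" if t: "t \<in> T" for t
  proof -
    have dvd: "int q ^ k dvd c 0 t" for k
    proof -
      have "(\<Sum>t\<in>T. of_int (c 0 t - int (q ^ k) * c k t) * t) =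
          (\<Sum>t\<in>T. of_int (c 0 t) * t) - of_nat (q ^ k) * (\<Sum>t\<in>T. of_int (c k t) * t)"
        by (simp add: sum_subtractf sum_distrib_left algebra_simps)
      also have "\<dots> = 0" using c[of 0] c[of k] by simp
      finally have "c 0 t - int (q ^ k) * c k t = 0"
        using indep[of "\<lambda>t. c 0 t - int (q ^ k) * c k t"] t by blast
      thus ?thesis by simp
    qed
    define m where "m = nat \<bar>c 0 t\<bar>"
    (* A nonzero integer is not divisible by a power exceeding its absolute value. *)
    have "\<bar>c 0 t\<bar> < int q ^ m"
    proof -
      have "m < q ^ m" by (rule power_gt_expt[OF q[unfolded One_nat_def]])
      hence "int m < int (q ^ m)" by (simp only: of_nat_less_iff)
      thus ?thesis by (simp add: m_def)
    qed
    thus ?thesis using dvd_imp_le_int[OF _ dvd[of m]] by force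
  qed
  hence "of_int N * \<beta> = 0" using c[of 0] by simp
  thus ?thesis using N(1) by simp
qed

lemma int_span_coprime_divisible:
  assumes z: "z \<in> int_span S" and cop: "coprime a b"
    and w: "w \<in> int_span S" "of_nat a * z = of_nat b * w"
  shows "\<exists>v\<in>int_span S. z = of_nat b * v"
proof -
  have "coprime (int a) (int b)" using cop by simp
  then obtain x y where xy: "x * int a + y * int b = 1"
    using bezout_int[of "int a" "int b"] by (auto simp: coprime_iff_gcd_eq_1)
  have "z = of_int (x * int a + y * int b) * z" unfolding xy by simp
  also have "\<dots> = of_int x * (of_nat a * z) + of_nat b * (of_int y * z)"
    by (simp add: algebra_simps)
  also have "\<dots> = of_nat b * (of_int x * w + of_int y * z)" unfolding w(2) by (simp add: algebra_simps)
  finally show ?thesis using int_span_add[OF int_span_scale[OF w(1), of x] int_span_scale[OF z, of y]] by blast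
qed

section \<open>Sums over lists that are invariant under rotation\<close>

lemma rotate_mult_fixed: "rotate m xs = xs \<Longrightarrow> rotate (a * m) xs = xs"
  by (induction a) (auto simp: rotate_rotate[symmetric] add.commute[of m])

lemma rotate_gcd_fixed:
  assumes "rotate m xs = xs" "m > 0"
  shows "rotate (gcd m (length xs)) xs = xs"
proof -
  obtain a b where ab: "m * a = length xs * b + gcd m (length xs)"
    using bezout_nat[of m "length xs"] assms(2) by auto
  have "rotate (gcd m (length xs)) xs = rotate (gcd m (length xs)) (rotate (b * length xs) xs)"
    by (subst rotate_mult_fixed) auto
  also have "\<dots> = rotate (a * m) xs"
    unfolding rotate_rotate using ab by (simp only: mult.commute add.commute)
  also have "\<dots> = xs" by (rule rotate_mult_fixed[OF assms(1)])
  finally show ?thesis .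
qed

lemma rotate_injective: "rotate i xs = rotate i ys \<Longrightarrow> xs = ys"
proof (induction i)
  case (Suc i)
  have inj: "as = bs" if "rotate1 as = rotate1 bs" for as bs :: "'a list"
    using that by (cases as; cases bs) auto
  have "rotate1 (rotate i xs) = rotate1 (rotate i ys)" using Suc.prems by simp
  from Suc.IH[OF inj[OF this]] show ?case .
qed simp

text \<open>
  The greatest common divisor of a period and the length is again a period. For length \<open>p\<^sup>k\<close> it is a
  power of \<open>p\<close>, so that a list with a proper period has the period \<open>p\<^sup>k\<^sup>-\<^sup>1\<close>. When this is excluded, each
  rotation orbit has exactly \<open>p\<^sup>k\<close> elements, on which \<open>w\<close> is constant.
\<close>

lemma sum_over_rotation_orbits:
  fixes w :: "'a list \<Rightarrow> complex"
  assumes p: "prime p" and k: "k > 0" and X: "finite X" "\<And>xs. xs \<in> X \<Longrightarrow> length xs = p ^ k"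
    and rot: "\<And>xs. xs \<in> X \<Longrightarrow> rotate1 xs \<in> X" "\<And>xs. xs \<in> X \<Longrightarrow> w (rotate1 xs) = w xs"
    and free: "\<And>xs. xs \<in> X \<Longrightarrow> rotate (p ^ (k - 1)) xs \<noteq> xs"
    and w: "\<And>xs. xs \<in> X \<Longrightarrow> w xs \<in> int_span S"
  shows "\<exists>b\<in>int_span S. (\<Sum>xs\<in>X. w xs) = of_nat (p ^ k) * b"
proof -
  have rotX: "rotate i xs \<in> X" and rotw: "w (rotate i xs) = w xs" if "xs \<in> X" for xs i
    using that rot by (induction i) auto
  define orb where "orb xs = (\<lambda>j. rotate j xs) ` {..<p ^ k}" for xs :: "'a list"
  have pk: "p ^ k > 0" using p by (simp add: prime_gt_0_nat)
  have orb_all: "rotate i xs \<in> orb xs" if "xs \<in> X" for xs i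
  proof -
    have "rotate i xs = rotate (i mod p ^ k) xs" using X(2)[OF that] by (metis rotate_conv_mod)
    thus ?thesis using pk by (auto simp: orb_def)
  qed
  have self: "xs \<in> orb xs" if "xs \<in> X" for xs using orb_all[OF that, of 0] by simp
  have orb_sub: "orb xs \<subseteq> X" if "xs \<in> X" for xs using rotX[OF that] by (auto simp: orb_def)
  have orb_mono: "orb ys \<subseteq> orb xs" if xs: "xs \<in> X" and ys: "ys \<in> orb xs" for xs ys
  proof
    fix zs assume "zs \<in> orb ys"
    then obtain i j where "ys = rotate i xs" "zs = rotate j ys" using ys by (auto simp: orb_def)
    hence "zs = rotate (j + i) xs" by (simp add: rotate_rotate)
    thus "zs \<in> orb xs" using orb_all[OF xs] by simp
  qed
  have orb_sym: "xs \<in> orb ys" if xs: "xs \<in> X" and ys: "ys \<in> orb xs" for xs ys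
  proof -
    obtain i where i: "ys = rotate i xs" "i < p ^ k" using ys by (auto simp: orb_def)
    have "rotate (p ^ k - i) ys = rotate (p ^ k) xs" using i by (simp add: rotate_rotate)
    also have "\<dots> = xs" using X(2)[OF xs] by simp
    finally show ?thesis using orb_all[of ys "p ^ k - i"] orb_sub[OF xs] ys by auto
  qed
  have orb_eq: "orb ys = orb xs" if xs: "xs \<in> X" and ys: "ys \<in> orb xs" for xs ys
    using orb_mono[OF xs ys] orb_mono[OF _ orb_sym[OF xs ys]] orb_sub[OF xs] ys by blast
  have disj: "A \<inter> B = {}" if "A \<in> orb ` X" "B \<in> orb ` X" "A \<noteq> B" for A B
    using that orb_eq by blast
  have inj: "inj_on (\<lambda>j. rotate j xs) {..<p ^ k}" if xs: "xs \<in> X" for xs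
  proof (rule linorder_inj_onI')
    fix i j assume ij: "i \<in> {..<p ^ k}" "j \<in> {..<p ^ k}" "i < j"
    show "rotate i xs \<noteq> rotate j xs"
    proof
      assume "rotate i xs = rotate j xs"
      also have "rotate j xs = rotate i (rotate (j - i) xs)" using ij by (simp add: rotate_rotate)
      finally have "rotate (j - i) xs = xs" by (metis rotate_injective)
      from rotate_gcd_fixed[OF this] have g: "rotate (gcd (j - i) (p ^ k)) xs = xs"
        using ij X(2)[OF xs] by simp
      obtain t where t: "gcd (j - i) (p ^ k) = p ^ t" "t \<le> k"
        using divides_primepow_nat[OF p, of "gcd (j - i) (p ^ k)" k] by auto
      have "p ^ t \<le> j - i" using ij t(1) gcd_le1_nat[of "j - i" "p ^ k"] by simp
      hence "t \<noteq> k" using ij by auto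
      hence "p ^ (k - 1) = p ^ (k - 1 - t) * p ^ t" using t(2) by (simp add: power_add[symmetric])
      hence "rotate (p ^ (k - 1)) xs = xs" using rotate_mult_fixed[OF g[unfolded t(1)]] by metis
      thus False using free[OF xs] by blast
    qed
  qed
  have orb_sum: "(\<Sum>ys\<in>orb xs. w ys) = of_nat (p ^ k) * w xs" if xs: "xs \<in> X" for xs
  proof -
    have "(\<Sum>ys\<in>orb xs. w ys) = (\<Sum>j<p ^ k. w (rotate j xs))"
      unfolding orb_def by (subst sum.reindex[OF inj[OF xs]]) simp
    thus ?thesis by (simp add: rotw[OF xs])
  qed
  define rep where "rep A = (SOME xs. xs \<in> X \<and> orb xs = A)" for A
  have rep: "rep A \<in> X \<and> orb (rep A) = A" if "A \<in> orb ` X" for A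
    unfolding rep_def by (rule someI_ex) (use that in blast)
  have XU: "X = \<Union>(orb ` X)" using self orb_sub by blast
  have "(\<Sum>xs\<in>X. w xs) = (\<Sum>xs\<in>\<Union>(orb ` X). w xs)" using XU by simp
  also have "\<dots> = (\<Sum>A\<in>orb ` X. \<Sum>xs\<in>A. w xs)"
    by (subst sum.Union_disjoint) (use disj in \<open>auto simp: orb_def\<close>)
  also have "\<dots> = (\<Sum>A\<in>orb ` X. of_nat (p ^ k) * w (rep A))"
    by (intro sum.cong refl) (metis orb_sum rep)
  also have "\<dots> = of_nat (p ^ k) * (\<Sum>A\<in>orb ` X. w (rep A))" by (simp add: sum_distrib_left)
  finally show ?thesis using rep w by (intro bexI[of _ "\<Sum>A\<in>orb ` X. w (rep A)"] int_span_sum) auto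
qed

text \<open>
  If the rotation by \<open>r\<close> fixes \<open>xs = u v\<close>, where \<open>u\<close> has length \<open>r\<close>, then \<open>u v = v u\<close>, and commuting words
  are powers of a common word \<open>zs\<close>. Comparing lengths shows that the exponents add up to a multiple
  of \<open>q\<close>.
\<close>

lemma rotate_fixed_power:
  assumes len: "length xs = q * r" and r: "r > 0" and q: "q > 0" and per: "rotate r xs = xs"
  shows "\<exists>m zs. set zs \<subseteq> set xs \<and> xs = concat (replicate (q * m) zs)"
proof (cases "q = 1")
  case True
  thus ?thesis using len by (intro exI[of _ 1] exI[of _ xs]) simp
next
  case False
  hence q2: "q \<ge> 2" using q by simp
  have lt: "r < length xs" using r q2 len by simp
  define u v where "u = take r xs" and "v = drop r xs"
  have xs: "xs = u @ v" by (simp add: u_def v_def)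
  have "rotate r xs = v @ u" using lt by (simp add: rotate_drop_take u_def v_def)
  hence "u @ v = v @ u" using per xs by simp
  from comm_append_are_replicate[OF this] obtain m n zs where
    mn: "concat (replicate m zs) = u" "concat (replicate n zs) = v" by blast
  have lu: "m * length zs = r"
    using arg_cong[OF mn(1), of length] lt by (simp add: u_def length_concat sum_list_replicate)
  have lv: "n * length zs = (q - 1) * r"
    using arg_cong[OF mn(2), of length] lt len
    by (simp add: v_def length_concat sum_list_replicate diff_mult_distrib)
  have zs0: "length zs > 0" using lu r by (cases zs) auto
  have "n * length zs = ((q - 1) * m) * length zs" using lu lv by (simp add: mult.assoc)
  hence "n = (q - 1) * m" using zs0 by (metis mult_cancel2 less_numeral_extra(3))
  hence "m + n = q * m" using q by (cases q) auto
  have cc: "xs = concat (replicate (m + n) zs)" unfolding xs mn[symmetric] by (simp add: replicate_add)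
  moreover have "m > 0" using lu r by (cases m) auto
  hence "set zs \<subseteq> set xs" unfolding cc by (cases m) auto
  ultimately show ?thesis using \<open>m + n = q * m\<close> by (metis)
qed

context fin_group
begin

section \<open>Degrees and zeros of irreducible characters\<close>

definition unity_roots :: "complex set" where
  "unity_roots = {z. z ^ order G = 1}"

lemma unity_roots: "finite unity_roots" "1 \<in> unity_roots" "s \<in> unity_roots \<Longrightarrow> t \<in> unity_roots \<Longrightarrow> s * t \<in> unity_roots"
  using order_pos finite_nth_roots[of "order G" 1] by (auto simp: unity_roots_def power_mult_distrib)

lemma character_int_span: "gmod V \<Longrightarrow> g \<in> carrier G \<Longrightarrow> character V g \<in> int_span unity_roots"
proof -
  assume "gmod V" "g \<in> carrier G"
  then obtain t where t: "\<And>i. i < vdim V \<Longrightarrow> t i ^ order G = 1"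
    and chi: "\<And>k::nat. character V (g [^] k) = (\<Sum>i<vdim V. t i ^ k)"
    using character_eigenvalues by metis
  have "character V g = (\<Sum>i<vdim V. t i)" using chi[of 1] \<open>g \<in> carrier G\<close> by simp
  also have "\<dots> \<in> int_span unity_roots"
    by (intro int_span_sum int_span_base unity_roots(1)) (auto simp: unity_roots_def t)
  finally show ?thesis .
qed

lemma character_prod_int_span:
  assumes "gmod V" "set xs \<subseteq> carrier G"
  shows "(\<Prod>x\<leftarrow>xs. character V x) \<in> int_span unity_roots"
  using assms by (intro int_span_prod_list unity_roots character_int_span) auto

text \<open>
  Write \<open>|G| / d = u / v\<close> in lowest terms. By the convolution formula at the identity
  \<open>d (u / v)\<^sup>L\<close> is an integer combination of roots of unity for all \<open>L\<close>. So \<open>v\<^sup>L\<close> divides \<open>d\<close> in their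
  span for all \<open>L\<close>, which forces \<open>v = 1\<close>.
\<close>

theorem degree_dvd_order:
  assumes M: "simple_cg_module G M"
  shows "vdim M dvd order G"
proof -
  have gM: "gmod M" and d: "vdim M \<noteq> 0" using M by (auto simp: simple_cg_module_def)
  have g0: "gcd (order G) (vdim M) \<noteq> 0" using d by simp
  obtain c u v where c0: "c \<noteq> 0" and u: "order G = u * c" and v: "vdim M = v * c" and uv: "coprime u v"
    using gcd_coprime_exists[OF g0] g0 by blast
  have v0: "v \<noteq> 0" using v d by auto
  have "v = 1"
  proof (rule ccontr)
    assume "v \<noteq> 1"
    hence v1: "v > 1" using v0 by simp
    have d_span: "of_nat (vdim M) \<in> int_span unity_roots"
      using character_int_span[OF gM one_closed] by (simp add: character_one[OF gM])
    have "\<exists>b\<in>int_span unity_roots. of_nat (vdim M) = of_nat (v ^ L) * b" for L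
    proof (rule int_span_coprime_divisible[OF d_span])
      show "coprime (u ^ L) (v ^ L)" using uv by simp
      let ?s = "\<Sum>xs\<in>factorizations (Suc L) \<one>. \<Prod>x\<leftarrow>xs. character M x"
      show "?s \<in> int_span unity_roots"
        by (intro int_span_sum character_prod_int_span gM) (auto simp: factorizations_def)
      have "?s = (of_nat u / of_nat v) ^ L * of_nat (vdim M)"
        using c0 by (simp add: character_iterated_convolution[OF M one_closed] character_one[OF gM] u v)
      thus "of_nat (u ^ L) * of_nat (vdim M) = of_nat (v ^ L) * ?s"
        using v0 by (simp add: power_divide)
    qed
    from int_span_infinitely_divisible[OF unity_roots(1) v1 this] show False using d by simp
  qed
  thus ?thesis using u v by simp
qed

text \<open>
  Sum \<open>\<chi>(g\<^sub>1) \<dots> \<chi>(g\<^sub>L)\<close> over the tuples of length \<open>L = p\<^sup>k\<close> whose product lies in the conjugacy class \<open>K\<close>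
  of \<open>x\<close>. By the convolution formula the sum is \<open>|K| (|G| / d)\<^sup>L\<^sup>-\<^sup>1 \<chi>(x)\<close>. Rotating a tuple conjugates
  its product, so rotation acts on these tuples. It acts freely: a tuple with a proper period would
  make a conjugate of \<open>x\<close> a power \<open>y\<^sup>p\<close>; then the order of \<open>y\<close> would divide \<open>p\<^sup>2\<close> and \<open>|G|\<close>, hence \<open>p\<close>,
  and \<open>y\<^sup>p\<close> would be the identity. So the sum is divisible by \<open>p\<^sup>k\<close>. As \<open>|G| / d\<close> is prime to \<open>p\<close>, it
  follows that \<open>|K| \<chi>(x)\<close> is divisible by all powers of \<open>p\<close>.
\<close>

theorem character_vanishes_on_order_p:
  assumes M: "simple_cg_module G M" and p: "prime p" "p dvd vdim M" "\<not> p\<^sup>2 dvd order G"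
    and x: "x \<in> carrier G" "x [^] p = \<one>" "x \<noteq> \<one>"
  shows "character M x = 0"
proof -
  have gM: "gmod M" and d: "vdim M \<noteq> 0" using M by (auto simp: simple_cg_module_def)
  obtain t where t: "order G = vdim M * t" using degree_dvd_order[OF M] by blast
  have pt: "\<not> p dvd t"
  proof
    assume "p dvd t"
    hence "p * p dvd vdim M * t" using p(2) by (intro mult_dvd_mono)
    thus False using p(3) t by (simp add: power2_eq_square)
  qed
  define K where "K = (\<lambda>c. c \<otimes> x \<otimes> inv c) ` carrier G"
  have K: "finite K" "K \<noteq> {}" "K \<subseteq> carrier G"
    unfolding K_def using x(1) one_closed by (simp, blast, blast)
  have conjK: "c \<otimes> y \<otimes> inv c \<in> K" if c: "c \<in> carrier G" and y: "y \<in> K" for c y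
  proof -
    obtain b where b: "b \<in> carrier G" "y = b \<otimes> x \<otimes> inv b" using y unfolding K_def by blast
    have "c \<otimes> y \<otimes> inv c = (c \<otimes> b) \<otimes> x \<otimes> inv (c \<otimes> b)"
      using b c x(1) by (simp add: m_assoc inv_mult_group)
    thus ?thesis using b(1) c unfolding K_def by (intro image_eqI[where x = "c \<otimes> b"]) auto
  qed
  have powK: "y [^] m = \<one> \<longleftrightarrow> x [^] m = \<one>" if y: "y \<in> K" for y and m :: nat
  proof -
    obtain b where b: "b \<in> carrier G" "y = b \<otimes> x \<otimes> inv b" using y unfolding K_def by blast
    have "y [^] m = b \<otimes> x [^] m \<otimes> inv b"
    proof (induction m)
      case (Suc m)
      have "inv b \<otimes> (b \<otimes> (x \<otimes> inv b)) = x \<otimes> inv b"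
        using b(1) x(1) by (simp add: m_assoc[symmetric])
      thus ?case using Suc b x(1) by (simp add: m_assoc)
    qed (use b in simp)
    moreover have "z = \<one>" if "z \<in> carrier G" "b \<otimes> z \<otimes> inv b = \<one>" for z
    proof -
      have "z = inv b \<otimes> (b \<otimes> z \<otimes> inv b) \<otimes> b" using b(1) that(1) by (simp add: m_assoc) (simp add: m_assoc[symmetric])
      thus ?thesis using b(1) by (simp add: that(2))
    qed
    ultimately show ?thesis using x(1) b(1) by auto
  qed
  let ?\<beta> = "of_nat (card K) * character M x"
  have \<beta>: "?\<beta> \<in> int_span unity_roots"
    using int_span_scale[OF character_int_span[OF gM x(1)], of "int (card K)"] by simp
  have "\<exists>b\<in>int_span unity_roots. ?\<beta> = of_nat (p ^ k) * b" for k
  proof (cases "k = 0")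
    case True
    thus ?thesis using \<beta> by auto
  next
    case False
    define L where "L = p ^ k - 1"
    have SL: "Suc L = p ^ k" using p(1) by (simp add: L_def prime_gt_0_nat)
    define X where "X = (\<Union>y\<in>K. factorizations (Suc L) y)"
    have X_iff: "xs \<in> X \<longleftrightarrow> length xs = p ^ k \<and> set xs \<subseteq> carrier G \<and> list_prod xs \<in> K" for xs
      using K by (auto simp: X_def factorizations_def SL)
    have "\<exists>b\<in>int_span unity_roots. (\<Sum>xs\<in>X. \<Prod>x\<leftarrow>xs. character M x) = of_nat (p ^ k) * b"
    proof (rule sum_over_rotation_orbits[OF p(1)])
      show "k > 0" using False by simp
      show "finite X" using K finite_factorizations by (auto simp: X_def)
      show "length xs = p ^ k" if "xs \<in> X" for xs using that X_iff by blast
      show "(\<Prod>x\<leftarrow>rotate1 xs. character M x) = (\<Prod>x\<leftarrow>xs. character M x)" for xs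
        by (cases xs) (auto simp: mult.commute)
      show "(\<Prod>x\<leftarrow>xs. character M x) \<in> int_span unity_roots" if "xs \<in> X" for xs
        using that X_iff by (intro character_prod_int_span gM) blast
      show "rotate1 xs \<in> X" if xs: "xs \<in> X" for xs
      proof (cases xs)
        case (Cons a ys)
        have a: "a \<in> carrier G" and ys: "set ys \<subseteq> carrier G" and K: "a \<otimes> list_prod ys \<in> K"
          using xs X_iff Cons by auto
        have "list_prod (ys @ [a]) = inv a \<otimes> (a \<otimes> list_prod ys) \<otimes> inv (inv a)"
          using a ys by (simp add: list_prod_append m_assoc[symmetric])
        also have "\<dots> \<in> K" by (rule conjK[OF _ K]) (use a in simp)
        finally show ?thesis using xs Cons by (auto simp: X_iff)
      qed (use xs in simp)
      show "rotate (p ^ (k - 1)) xs \<noteq> xs" if xs: "xs \<in> X" for xs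
      proof
        assume per: "rotate (p ^ (k - 1)) xs = xs"
        have "length xs = p * p ^ (k - 1)" using xs X_iff False by (metis power_eq_if)
        from rotate_fixed_power[OF this _ _ per] obtain m zs where
          zs: "set zs \<subseteq> set xs" "xs = concat (replicate (p * m) zs)"
          using p(1) by (auto simp: prime_gt_0_nat)
        define y where "y = list_prod zs [^] m"
        have zc: "set zs \<subseteq> carrier G" using zs xs X_iff by blast
        hence y: "y \<in> carrier G" by (simp add: y_def)
        have "list_prod xs = list_prod zs [^] (p * m)"
          using zs(2) list_prod_concat_replicate[OF zc] by simp
        also have "\<dots> = y [^] p" using zc by (simp add: y_def nat_pow_pow mult.commute)
        finally have yK: "y [^] p \<in> K" using xs X_iff by metis
        hence "(y [^] p) [^] p = \<one>" using powK x(2) by blast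
        hence "y [^] (p * p) = \<one>" using y by (simp add: nat_pow_pow)
        hence "ord y dvd p\<^sup>2" using y by (simp add: pow_eq_id power2_eq_square)
        then obtain i where i: "i \<le> 2" "ord y = p ^ i" using p(1) by (metis divides_primepow_nat)
        have "ord y dvd order G" using y by (rule ord_dvd_group_order)
        hence "i \<noteq> 2" using i p(3) by auto
        hence "ord y dvd p ^ 1" unfolding i(2) using i(1) by (intro le_imp_power_dvd) simp
        hence "y [^] p = \<one>" using y by (simp add: pow_eq_id)
        hence "(y [^] p) [^] (1::nat) = \<one>" by simp
        hence "x [^] (1::nat) = \<one>" using powK[OF yK, of 1] by blast
        thus False using x by simp
      qed
    qed
    then obtain b where b: "b \<in> int_span unity_roots"
      "(\<Sum>xs\<in>X. \<Prod>x\<leftarrow>xs. character M x) = of_nat (p ^ k) * b" by blast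
    have "(\<Sum>xs\<in>X. \<Prod>x\<leftarrow>xs. character M x) =
        (\<Sum>y\<in>K. \<Sum>xs\<in>factorizations (Suc L) y. \<Prod>x\<leftarrow>xs. character M x)"
      unfolding X_def
      by (rule sum.UNION_disjoint) (use K finite_factorizations in \<open>auto simp: factorizations_def\<close>)
    also have "\<dots> = (\<Sum>y\<in>K. of_nat t ^ L * character M x)"
    proof (intro sum.cong refl)
      fix y assume y: "y \<in> K"
      have "character M y = character M x" using y x gM by (auto simp: K_def character_conj)
      thus "(\<Sum>xs\<in>factorizations (Suc L) y. \<Prod>x\<leftarrow>xs. character M x) = of_nat t ^ L * character M x"
        using character_iterated_convolution[OF M, of y L] y K d by (auto simp: t)
    qed
    finally have eq: "of_nat (t ^ L) * ?\<beta> = of_nat (p ^ k) * b" using b by simp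
    have "coprime (t ^ L) (p ^ k)"
      using pt p(1) by (metis coprime_commute coprime_power_left_iff coprime_power_right_iff prime_imp_coprime_nat)
    from int_span_coprime_divisible[OF \<beta> this b(1) eq] show ?thesis .
  qed
  from int_span_infinitely_divisible[OF unity_roots(1) prime_gt_1_nat[OF p(1)] this]
  have "?\<beta> = 0" .
  thus ?thesis using K by simp
qed


section \<open>Direct sums, tensor products and permutation modules\<close>

lemma direct_sum_Cons:
  "act (cg_direct_sum (M # Ms)) g = four_block_mat (act M g)
    (0\<^sub>m (dim_row (act M g)) (dim_col (act (cg_direct_sum Ms) g)))
    (0\<^sub>m (dim_row (act (cg_direct_sum Ms) g)) (dim_col (act M g))) (act (cg_direct_sum Ms) g)"
  "vdim (cg_direct_sum (M # Ms)) = vdim M + vdim (cg_direct_sum Ms)"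
  by (simp_all add: cg_direct_sum_def Let_def)

lemma direct_sum_module:
  assumes "\<forall>M\<in>set Ms. gmod M"
  shows "gmod (cg_direct_sum Ms)"
    and "g \<in> carrier G \<Longrightarrow> character (cg_direct_sum Ms) g = (\<Sum>M\<leftarrow>Ms. character M g)"
proof -
  have "gmod (cg_direct_sum Ms) \<and>
      (\<forall>g\<in>carrier G. character (cg_direct_sum Ms) g = (\<Sum>M\<leftarrow>Ms. character M g))"
    using assms
  proof (induction Ms)
    case Nil
    have "0\<^sub>m 0 0 = (1\<^sub>m 0 :: complex mat)" "0\<^sub>m 0 0 * 0\<^sub>m 0 0 = (0\<^sub>m 0 0 :: complex mat)"
      by (auto intro!: eq_matI)
    thus ?case by (simp add: cg_module_def cg_direct_sum_def character_def mat_trace_def)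
  next
    case (Cons M Ms)
    let ?N = "cg_direct_sum Ms" and ?S = "cg_direct_sum (M # Ms)"
    have M: "gmod M" and N: "gmod ?N"
      and chiN: "\<And>g. g \<in> carrier G \<Longrightarrow> character ?N g = (\<Sum>M\<leftarrow>Ms. character M g)"
      using Cons by auto
    note cM = act_carrier[OF M] and cN = act_carrier[OF N]
    have S: "act ?S g = four_block_mat (act M g) (0\<^sub>m (vdim M) (vdim ?N)) (0\<^sub>m (vdim ?N) (vdim M)) (act ?N g)"
      if "g \<in> carrier G" for g
      unfolding direct_sum_Cons using cM[OF that] cN[OF that] by simp
    have "gmod ?S"
      unfolding cg_module_def
    proof (intro conjI ballI)
      show "act ?S g \<in> carrier_mat (vdim ?S) (vdim ?S)" if g: "g \<in> carrier G" for g
        unfolding S[OF g] direct_sum_Cons(2) using cM[OF g] cN[OF g] by (rule four_block_carrier_mat)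
      show "act ?S \<one> = 1\<^sub>m (vdim ?S)"
        unfolding S[OF one_closed] direct_sum_Cons(2) act_one[OF M] act_one[OF N]
        by (rule four_block_one_mat)
      fix g h assume g: "g \<in> carrier G" and h: "h \<in> carrier G"
      show "act ?S (g \<otimes> h) = act ?S g * act ?S h"
        unfolding S[OF g] S[OF h] S[OF m_closed[OF g h]] act_mult[OF M g h] act_mult[OF N g h]
        using cM[OF g] cM[OF h] cN[OF g] cN[OF h]
        by (subst mult_four_block_mat[OF cM[OF g] _ _ cN[OF g] cM[OF h] _ _ cN[OF h]]) auto
    qed
    moreover have "character ?S g = (\<Sum>M\<leftarrow>M # Ms. character M g)" if g: "g \<in> carrier G" for g
      using mat_trace_four_block[OF cM[OF g] cN[OF g]] chiN[OF g] S[OF g] by (simp add: character_def)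
    ultimately show ?case by blast
  qed
  thus "gmod (cg_direct_sum Ms)"
    and "g \<in> carrier G \<Longrightarrow> character (cg_direct_sum Ms) g = (\<Sum>M\<leftarrow>Ms. character M g)" by auto
qed

end

lemma sum_div_mod:
  fixes f :: "nat \<Rightarrow> nat \<Rightarrow> 'a::comm_monoid_add"
  shows "(\<Sum>l<m * n. f (l div n) (l mod n)) = (\<Sum>a<m. \<Sum>b<n. f a b)"
proof -
  have "(\<Sum>l<m * n. f (l div n) (l mod n)) = (\<Sum>a<m. \<Sum>l=a * n..<a * n + n. f (l div n) (l mod n))"
    by (rule sum.nat_group[symmetric])
  also have "\<dots> = (\<Sum>a<m. \<Sum>b<n. f a b)"
  proof (rule sum.cong[OF refl])
    fix a
    have "(\<Sum>l=a * n..<a * n + n. f (l div n) (l mod n)) =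
        (\<Sum>b=0..<n. f ((b + a * n) div n) ((b + a * n) mod n))"
      using sum.shift_bounds_nat_ivl[of "\<lambda>l. f (l div n) (l mod n)" 0 "a * n" n]
      by (simp add: add.commute)
    also have "\<dots> = (\<Sum>b<n. f a b)" unfolding atLeast0LessThan by (intro sum.cong) auto
    finally show "(\<Sum>l=a * n..<a * n + n. f (l div n) (l mod n)) = (\<Sum>b<n. f a b)" .
  qed
  finally show ?thesis .
qed

lemma div_mod_bounds:
  assumes "i < m * (n::nat)"
  shows "i div n < m" "i mod n < n"
proof -
  have "n > 0" using assms by (cases n) auto
  thus "i mod n < n" by simp
  show "i div n < m" using assms by (rule less_mult_imp_div_less)
qed

lemma kronecker_carrier:
  "A \<in> carrier_mat n m \<Longrightarrow> B \<in> carrier_mat k l \<Longrightarrow> kronecker_product A B \<in> carrier_mat (n * k) (m * l)"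
  by (auto simp: kronecker_product_def)

lemma kronecker_mult:
  assumes A: "A \<in> carrier_mat n n" "A' \<in> carrier_mat n n" and B: "B \<in> carrier_mat k k" "B' \<in> carrier_mat k k"
  shows "kronecker_product (A * A') (B * B') = kronecker_product A B * kronecker_product A' B'"
proof (rule eq_matI)
  note KAB = kronecker_carrier[OF A(1) B(1)] and KAB' = kronecker_carrier[OF A(2) B(2)]
  fix i j assume "i < dim_row (kronecker_product A B * kronecker_product A' B')"
    "j < dim_col (kronecker_product A B * kronecker_product A' B')"
  hence ij: "i < n * k" "j < n * k" using KAB KAB' by auto
  note bi = div_mod_bounds[OF ij(1)] and bj = div_mod_bounds[OF ij(2)]
  have "kronecker_product (A * A') (B * B') $$ (i, j) =
      (A * A') $$ (i div k, j div k) * (B * B') $$ (i mod k, j mod k)"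
    using ij A B by (simp add: kronecker_product_def del: index_mult_mat(1))
  also have "\<dots> = (\<Sum>a<n. \<Sum>b<k. A $$ (i div k, a) * A' $$ (a, j div k) * (B $$ (i mod k, b) * B' $$ (b, j mod k)))"
    using index_mult_mat_sum[OF A bi(1) bj(1)] index_mult_mat_sum[OF B bi(2) bj(2)]
    by (simp only: sum_product)
  also have "\<dots> = (\<Sum>l<n * k. A $$ (i div k, l div k) * A' $$ (l div k, j div k) *
      (B $$ (i mod k, l mod k) * B' $$ (l mod k, j mod k)))"
    by (rule sum_div_mod[symmetric])
  also have "\<dots> = (\<Sum>l<n * k. kronecker_product A B $$ (i, l) * kronecker_product A' B' $$ (l, j))"
    using ij A B by (intro sum.cong refl) (simp add: kronecker_product_def)
  also have "\<dots> = (kronecker_product A B * kronecker_product A' B') $$ (i, j)"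
    by (rule index_mult_mat_sum[OF KAB KAB' ij, symmetric])
  finally show "kronecker_product (A * A') (B * B') $$ (i, j) =
      (kronecker_product A B * kronecker_product A' B') $$ (i, j)" .
qed (use A B in \<open>auto simp: kronecker_product_def\<close>)

lemma kronecker_one: "kronecker_product (1\<^sub>m n) (1\<^sub>m k) = 1\<^sub>m (n * k)"
proof (rule eq_matI)
  fix i j assume "i < dim_row (1\<^sub>m (n * k))" "j < dim_col (1\<^sub>m (n * k))"
  hence ij: "i < n * k" "j < n * k" by auto
  note bi = div_mod_bounds[OF ij(1)] and bj = div_mod_bounds[OF ij(2)]
  have "i = j \<longleftrightarrow> i div k = j div k \<and> i mod k = j mod k" by (metis div_mult_mod_eq)
  thus "kronecker_product (1\<^sub>m n) (1\<^sub>m k) $$ (i, j) = 1\<^sub>m (n * k) $$ (i, j)"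
    using ij bi bj by (simp add: kronecker_product_def)
qed (auto simp: kronecker_product_def)

lemma mat_trace_kronecker:
  assumes "A \<in> carrier_mat n n" "B \<in> carrier_mat k k"
  shows "mat_trace (kronecker_product A B) = mat_trace A * mat_trace B"
proof -
  have "mat_trace (kronecker_product A B) = (\<Sum>l<n * k. A $$ (l div k, l div k) * B $$ (l mod k, l mod k))"
    using assms by (simp add: mat_trace_def kronecker_product_def)
  also have "\<dots> = (\<Sum>a<n. \<Sum>b<k. A $$ (a, a) * B $$ (b, b))" by (rule sum_div_mod)
  finally show ?thesis using assms by (simp add: mat_trace_def sum_product)
qed

text \<open>
  The module with basis a finite set on which the group acts by \<open>\<phi>\<close>; the bijection \<open>f\<close> from \<open>{..<m}\<close>
  numbers the points of this set.
\<close>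

definition perm_module :: "(nat \<Rightarrow> 'x) \<Rightarrow> nat \<Rightarrow> ('g \<Rightarrow> 'x \<Rightarrow> 'x) \<Rightarrow> 'g cmod" where
  "perm_module f m \<phi> =
     \<lparr>vdim = m, act = (\<lambda>g. mat m m (\<lambda>(i, j). if f i = \<phi> g (f j) then 1 else 0))\<rparr>"

context fin_group
begin

lemma tensor_module:
  assumes V: "gmod V" and W: "gmod W"
  shows "gmod (cg_tensor V W)"
    and "g \<in> carrier G \<Longrightarrow> character (cg_tensor V W) g = character V g * character W g"
proof -
  show "gmod (cg_tensor V W)"
    unfolding cg_module_def
    using act_carrier[OF V] act_carrier[OF W]
    by (auto simp: cg_tensor_def act_one[OF V] act_one[OF W] act_mult[OF V] act_mult[OF W]
        intro!: kronecker_carrier kronecker_one kronecker_mult)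
  show "g \<in> carrier G \<Longrightarrow> character (cg_tensor V W) g = character V g * character W g"
    using mat_trace_kronecker[OF act_carrier[OF V] act_carrier[OF W]]
    by (simp add: character_def cg_tensor_def)
qed

lemma perm_module:
  assumes f: "bij_betw f {..<m} X"
    and closed: "\<And>g x. g \<in> carrier G \<Longrightarrow> x \<in> X \<Longrightarrow> \<phi> g x \<in> X"
    and one: "\<And>x. x \<in> X \<Longrightarrow> \<phi> \<one> x = x"
    and mult: "\<And>g h x. g \<in> carrier G \<Longrightarrow> h \<in> carrier G \<Longrightarrow> x \<in> X \<Longrightarrow> \<phi> (g \<otimes> h) x = \<phi> g (\<phi> h x)"
  shows "gmod (perm_module f m \<phi>)"
    and "character (perm_module f m \<phi>) g = of_nat (card {x \<in> X. \<phi> g x = x})"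
proof -
  have fX: "f i \<in> X" if "i < m" for i using f that by (auto dest: bij_betwE)
  have f_eq: "f i = f j \<longleftrightarrow> i = j" if "i < m" "j < m" for i j
    using f that by (auto simp: bij_betw_def inj_on_def)
  have f_ex: "\<exists>l<m. x = f l" if "x \<in> X" for x
    using f that by (auto simp: bij_betw_def)
  let ?M = "perm_module f m \<phi>"
  have M [simp]: "vdim ?M = m"
    "act ?M g = mat m m (\<lambda>(i, j). if f i = \<phi> g (f j) then 1 else 0)" for g
    by (auto simp: perm_module_def)
  show "gmod ?M"
    unfolding cg_module_def
  proof (intro conjI ballI)
    show "act ?M \<one> = 1\<^sub>m (vdim ?M)"
      by (intro eq_matI) (auto simp: one fX f_eq)
    fix g h assume g: "g \<in> carrier G" and h: "h \<in> carrier G"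
    have gM: "act ?M g \<in> carrier_mat m m" for g by simp
    show "act ?M (g \<otimes> h) = act ?M g * act ?M h"
    proof (rule eq_matI)
      fix i j assume "i < dim_row (act ?M g * act ?M h)" "j < dim_col (act ?M g * act ?M h)"
      hence ij: "i < m" "j < m" by auto
      obtain l0 where l0: "l0 < m" "\<phi> h (f j) = f l0" using f_ex[OF closed[OF h fX[OF ij(2)]]] by blast
      have "(act ?M g * act ?M h) $$ (i, j) = (\<Sum>l<m. act ?M g $$ (i, l) * act ?M h $$ (l, j))"
        by (rule index_mult_mat_sum[OF gM gM ij])
      also have "\<dots> = (\<Sum>l<m. if l = l0 then if f i = \<phi> g (f l0) then 1 else 0 else 0)"
        using ij l0 by (intro sum.cong refl) (auto simp: f_eq)
      also have "\<dots> = act ?M (g \<otimes> h) $$ (i, j)"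
        using ij l0 by (simp add: mult[OF g h fX[OF ij(2)]])
      finally show "act ?M (g \<otimes> h) $$ (i, j) = (act ?M g * act ?M h) $$ (i, j)" by simp
    qed auto
  qed auto
  have "character ?M g = of_nat (card {i \<in> {..<m}. f i = \<phi> g (f i)})"
    by (simp add: character_def mat_trace_def sum.If_cases Int_def)
  also have "card {i \<in> {..<m}. f i = \<phi> g (f i)} = card {x \<in> X. \<phi> g x = x}"
  proof (rule bij_betw_same_card[of f])
    have "f ` {i \<in> {..<m}. f i = \<phi> g (f i)} = {x \<in> X. \<phi> g x = x}"
      using fX f_ex by force
    moreover have "inj_on f {i \<in> {..<m}. f i = \<phi> g (f i)}"
      using f by (auto simp: bij_betw_def inj_on_def)
    ultimately show "bij_betw f {i \<in> {..<m}. f i = \<phi> g (f i)} {x \<in> X. \<phi> g x = x}"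
      by (simp add: bij_betw_def)
  qed
  finally show "character ?M g = of_nat (card {x \<in> X. \<phi> g x = x})" .
qed

lemma group_enum_bij: "bij_betw (group_enum G) {..<order G} (carrier G)"
proof -
  have "\<exists>f. bij_betw f {..<order G} (carrier G)"
    using ex_bij_betw_nat_finite[OF fin_carrier] by (simp add: Coset.order_def atLeast0LessThan)
  thus ?thesis unfolding group_enum_def by (rule someI_ex)
qed

lemma regular_module:
  shows "gmod (regular_cg_module G)"
    and "g \<in> carrier G \<Longrightarrow> character (regular_cg_module G) g = (if g = \<one> then of_nat (order G) else 0)"
proof -
  have eq: "regular_cg_module G = perm_module (group_enum G) (order G) (\<otimes>)"
    by (simp add: regular_cg_module_def perm_module_def)
  note pm = perm_module[OF group_enum_bij, where \<phi> = "(\<otimes>)"]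
  show "gmod (regular_cg_module G)" unfolding eq by (rule pm) (auto simp: m_assoc)
  assume g: "g \<in> carrier G"
  have "{x \<in> carrier G. g \<otimes> x = x} = (if g = \<one> then carrier G else {})"
    using g by (auto simp: r_cancel_one')
  moreover have "character (regular_cg_module G) g = of_nat (card {x \<in> carrier G. g \<otimes> x = x})"
    unfolding eq by (rule pm) (auto simp: m_assoc)
  ultimately show "character (regular_cg_module G) g = (if g = \<one> then of_nat (order G) else 0)"
    by (simp add: Coset.order_def)
qed

text \<open>
  The character of the permutation module on the cosets of \<open>H\<close> counts fixed cosets, and \<open>g\<close> fixes the
  coset \<open>H a\<close> exactly if \<open>a g\<^sup>-\<^sup>1 a\<^sup>-\<^sup>1 \<in> H\<close>.
\<close>

lemma coset_module:
  assumes H: "subgroup H G"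
  obtains V where "gmod V" "vdim V * card H = order G"
    "\<And>g. g \<in> carrier G \<Longrightarrow> character V g \<noteq> 0 \<Longrightarrow> \<exists>a\<in>carrier G. a \<otimes> inv g \<otimes> inv a \<in> H"
proof -
  have Hc: "H \<subseteq> carrier G" by (rule subgroup.subset[OF H])
  have fin: "finite (rcosets H)" by (simp add: RCOSETS_def)
  then obtain f where f: "bij_betw f {..<card (rcosets H)} (rcosets H)"
    using ex_bij_betw_nat_finite by (metis atLeast0LessThan)
  (* Right cosets carry the left action by right multiplication with the inverse. *)
  let ?V = "perm_module f (card (rcosets H)) (\<lambda>g C. C #> inv g)"
  have C: "C \<subseteq> carrier G" if "C \<in> rcosets H" for C
    using subgroup.rcosets_carrier[OF H group_axioms that] .
  have closed: "C #> inv g \<in> rcosets H" if g: "g \<in> carrier G" and C: "C \<in> rcosets H" for g C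
  proof -
    obtain a where a: "a \<in> carrier G" "C = H #> a" using C by (auto simp: RCOSETS_def)
    have "C #> inv g = H #> (a \<otimes> inv g)" using a g Hc by (simp add: coset_mult_assoc)
    thus ?thesis using a g Hc by (simp add: rcosetsI)
  qed
  note pm = perm_module[OF f, of "\<lambda>g C. C #> inv g", OF closed]
  have one: "C #> inv \<one> = C" if "C \<in> rcosets H" for C using C[OF that] by simp
  have mult: "C #> inv (g \<otimes> h) = C #> inv h #> inv g"
    if "g \<in> carrier G" "h \<in> carrier G" "C \<in> rcosets H" for g h C
    using C that by (simp add: coset_mult_assoc inv_mult_group)
  have "\<exists>a\<in>carrier G. a \<otimes> inv g \<otimes> inv a \<in> H" if g: "g \<in> carrier G" "character ?V g \<noteq> 0" for g
  proof -
    have "character ?V g = of_nat (card {C \<in> rcosets H. C #> inv g = C})"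
      by (rule pm(2)[OF _ _ one mult])
    hence "card {C \<in> rcosets H. C #> inv g = C} \<noteq> 0" using g(2) by simp
    hence "{C \<in> rcosets H. C #> inv g = C} \<noteq> {}" by (metis card.empty)
    then obtain a where a: "a \<in> carrier G" "H #> a #> inv g = H #> a" by (auto simp: RCOSETS_def)
    hence "H #> (a \<otimes> inv g) = H #> a" using g Hc by (simp add: coset_mult_assoc)
    hence "H #> (a \<otimes> inv g \<otimes> inv a) = H" using a g Hc by (intro coset_mult_inv2) auto
    hence "a \<otimes> inv g \<otimes> inv a \<in> H" using a g H by (intro coset_join1[of H]) auto
    thus ?thesis using a by blast
  qed
  moreover have "gmod ?V" by (rule pm(1)[OF _ _ one mult])
  moreover have "vdim ?V * card H = order G" using lagrange[OF H] by (simp add: perm_module_def)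
  ultimately show ?thesis using that by blast
qed

section \<open>Virtual characters\<close>

definition virtual_character :: "(int \<times> 'a cmod) list \<Rightarrow> 'a \<Rightarrow> complex" where
  "virtual_character X g = (\<Sum>(a, M)\<leftarrow>X. of_int a * character M g)"

lemma virtual_character_parts:
  assumes X: "\<forall>(a, M)\<in>set X. gmod M"
  shows "gmod (pos_part X)" "gmod (neg_part X)"
    and "g \<in> carrier G \<Longrightarrow> character (pos_part X) g - character (neg_part X) g = virtual_character X g"
proof -
  have pos: "\<forall>M\<in>set (concat (map (\<lambda>(a, M). replicate (nat a) M) X)). gmod M"
    and neg: "\<forall>M\<in>set (concat (map (\<lambda>(a, M). replicate (nat (- a)) M) X)). gmod M"
    using X by auto
  show "gmod (pos_part X)" "gmod (neg_part X)"
    unfolding pos_part_def neg_part_def by (rule direct_sum_module[OF pos], rule direct_sum_module[OF neg])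
  assume g: "g \<in> carrier G"
  have "of_nat (nat a) - of_nat (nat (- a)) = (of_int a :: complex)" for a :: int
    by (cases "a \<ge> 0") auto
  hence nat_diff: "of_nat (nat a) * c - of_nat (nat (- a)) * c = of_int a * c" for a :: int and c :: complex
    by (metis left_diff_distrib)
  show "character (pos_part X) g - character (neg_part X) g = virtual_character X g"
    unfolding pos_part_def neg_part_def direct_sum_module(2)[OF pos g] direct_sum_module(2)[OF neg g]
      virtual_character_def
  proof (induction X)
    case (Cons x X)
    obtain a M where [simp]: "x = (a, M)" by force
    show ?case using Cons nat_diff[of a "character M g"]
      by (simp add: sum_list_replicate algebra_simps)
  qed simp
qed

text \<open>
  Equality of characters gives an isomorphism directly, so that the zero module suffices as the
  auxiliary summand in the definition of equality in the representation ring.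
\<close>

lemma rep_ring_eqI:
  assumes X: "\<forall>(a, M)\<in>set X. gmod M" and Y: "\<forall>(a, M)\<in>set Y. gmod M"
    and eq: "\<And>g. g \<in> carrier G \<Longrightarrow> virtual_character X g = virtual_character Y g"
  shows "rep_ring_eq G X Y"
proof -
  note pX = virtual_character_parts[OF X] and pY = virtual_character_parts[OF Y]
  define E where "E = cg_direct_sum ([] :: 'a cmod list)"
  have E: "gmod E" unfolding E_def by (rule direct_sum_module) simp
  have m1: "\<forall>M\<in>set [pos_part X, neg_part Y, E]. gmod M" and m2: "\<forall>M\<in>set [pos_part Y, neg_part X, E]. gmod M"
    using pX(1,2) pY(1,2) E by auto
  have "cg_iso G (cg_direct_sum [pos_part X, neg_part Y, E]) (cg_direct_sum [pos_part Y, neg_part X, E])"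
  proof (rule equal_characters_iso[OF direct_sum_module(1)[OF m1] direct_sum_module(1)[OF m2]])
    fix g assume g: "g \<in> carrier G"
    show "character (cg_direct_sum [pos_part X, neg_part Y, E]) g =
        character (cg_direct_sum [pos_part Y, neg_part X, E]) g"
      unfolding direct_sum_module(2)[OF m1 g] direct_sum_module(2)[OF m2 g]
      using pX(3)[OF g] pY(3)[OF g] eq[OF g] by (simp add: algebra_simps)
  qed
  thus ?thesis unfolding rep_ring_eq_def using E by blast
qed

section \<open>The Knutson index of a simple module\<close>

text \<open>
  The equation \<open>M \<otimes> N = n \<complex>[G]\<close> in terms of characters.
\<close>

definition regular_multiple :: "'a cmod \<Rightarrow> int \<Rightarrow> bool" where
  "regular_multiple M n \<longleftrightarrow> (\<exists>N. virtual_module G N \<and> (\<forall>g\<in>carrier G.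
     character M g * virtual_character N g = of_int n * character (regular_cg_module G) g))"

lemma regular_multiple_add:
  assumes "regular_multiple M m" "regular_multiple M n"
  shows "regular_multiple M (m + n)"
proof -
  obtain N N' where "virtual_module G N" "virtual_module G N'"
    and "\<And>g. g \<in> carrier G \<Longrightarrow> character M g * virtual_character N g = of_int m * character (regular_cg_module G) g"
    and "\<And>g. g \<in> carrier G \<Longrightarrow> character M g * virtual_character N' g = of_int n * character (regular_cg_module G) g"
    using assms unfolding regular_multiple_def by blast
  thus ?thesis unfolding regular_multiple_def
    by (intro exI[of _ "N @ N'"]) (auto simp: virtual_module_def virtual_character_def algebra_simps)
qed

lemma regular_multiple_scale:
  assumes "regular_multiple M n"
  shows "regular_multiple M (k * n)"
proof -
  obtain N where N: "virtual_module G N"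
    and eq: "\<And>g. g \<in> carrier G \<Longrightarrow> character M g * virtual_character N g = of_int n * character (regular_cg_module G) g"
    using assms unfolding regular_multiple_def by blast
  have "virtual_character (map (\<lambda>(a, S). (k * a, S)) N) g = of_int k * virtual_character N g" for g
    unfolding virtual_character_def by (induction N) (auto simp: algebra_simps)
  thus ?thesis unfolding regular_multiple_def
    using N eq by (intro exI[of _ "map (\<lambda>(a, S). (k * a, S)) N"]) (auto simp: virtual_module_def)
qed

text \<open>
  The character of \<open>\<complex>[G/H]\<close> vanishes off the conjugates of \<open>H\<close>, and \<open>\<chi>\<^sub>M\<close> vanishes on these
  except at the identity. So their product is a multiple of the regular character.
\<close>

lemma regular_multiple_coset:
  assumes M: "gmod M" and H: "subgroup H G" and van: "\<And>h. h \<in> H \<Longrightarrow> h \<noteq> \<one> \<Longrightarrow> character M h = 0"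
    and d: "vdim M = n * card H"
  shows "regular_multiple M (int n)"
proof -
  obtain V where V: "gmod V" "vdim V * card H = order G"
    and supp: "\<And>g. g \<in> carrier G \<Longrightarrow> character V g \<noteq> 0 \<Longrightarrow> \<exists>a\<in>carrier G. a \<otimes> inv g \<otimes> inv a \<in> H"
    using coset_module[OF H] by metis
  obtain Ss where Ss: "\<forall>S\<in>set Ss. simple_cg_module G S"
    and chi: "\<And>g. g \<in> carrier G \<Longrightarrow> character V g = (\<Sum>S\<leftarrow>Ss. character S g)"
    using character_sum_of_simple[OF V(1)] by blast
  let ?N = "map (\<lambda>S. (1::int, S)) Ss"
  have vc: "virtual_character ?N g = character V g" if "g \<in> carrier G" for g
    unfolding virtual_character_def chi[OF that] by (simp add: comp_def)
  have "character M g * character V g = of_int (int n) * character (regular_cg_module G) g"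
    if g: "g \<in> carrier G" for g
  proof (cases "g = \<one>")
    case True
    have "vdim M * vdim V = n * order G" using d V(2) by (simp add: mult.assoc mult.commute)
    hence "of_nat (vdim M) * of_nat (vdim V) = (of_nat n * of_nat (order G) :: complex)"
      by (metis of_nat_mult)
    thus ?thesis unfolding True
      by (simp add: regular_module(2) character_one[OF M] character_one[OF V(1)])
  next
    case False
    have "character M g = 0" if nz: "character V g \<noteq> 0"
    proof -
      obtain a where a: "a \<in> carrier G" "a \<otimes> inv g \<otimes> inv a \<in> H" using supp[OF g nz] by blast
      have "a \<otimes> inv g \<otimes> inv a \<noteq> \<one>"
      proof
        assume eq: "a \<otimes> inv g \<otimes> inv a = \<one>"
        have "inv g = inv a \<otimes> (a \<otimes> inv g \<otimes> inv a) \<otimes> a"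
          using a(1) g by (simp add: m_assoc) (simp add: m_assoc[symmetric])
        also have "\<dots> = \<one>" unfolding eq using a(1) by simp
        finally show False using g False by (metis inv_inv inv_one)
      qed
      hence "character M (a \<otimes> inv g \<otimes> inv a) = 0" by (rule van[OF a(2)])
      hence "cnj (character M g) = 0"
        using character_conj[OF M inv_closed[OF g] a(1)] character_inv[OF M g] by simp
      thus ?thesis by simp
    qed
    thus ?thesis using g False by (auto simp: regular_module(2))
  qed
  thus ?thesis unfolding regular_multiple_def
    using Ss vc by (intro exI[of _ ?N]) (auto simp: virtual_module_def)
qed

text \<open>
  The integers \<open>n\<close> for which \<open>M \<otimes> N = n \<complex>[G]\<close> is solvable form an ideal. It contains \<open>d = dim M\<close>
  and \<open>d / p\<close> for every prime divisor \<open>p\<close> of \<open>d\<close>, so that a generator of it which had a prime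
  divisor \<open>p\<close> would force \<open>p\<^sup>2\<close> to divide \<open>d\<close>.
\<close>

theorem regular_multiple_one:
  assumes sf: "squarefree (order G)" and M: "simple_cg_module G M"
  shows "regular_multiple M 1"
proof -
  have gM: "gmod M" and d0: "vdim M \<noteq> 0" using M by (auto simp: simple_cg_module_def)
  have sq: "\<not> p\<^sup>2 dvd order G" if "prime p" for p :: nat
    using squarefreeD[OF sf, of p] that by (auto simp: not_prime_unit)
  have d: "regular_multiple M (int (vdim M))"
    by (rule regular_multiple_coset[OF gM triv_subgroup]) auto
  have dp: "regular_multiple M (int (vdim M div p))" if p: "prime p" "p dvd vdim M" for p
  proof -
    have "p dvd order G" using p(2) degree_dvd_order[OF M] dvd_trans by blast
    then obtain m where "order G = p ^ 1 * m" by auto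
    from sylow_thm[OF p(1) group_axioms this fin_carrier] obtain H where
      H: "subgroup H G" "card H = p" by auto
    show ?thesis
    proof (rule regular_multiple_coset[OF gM H(1)])
      show "vdim M = vdim M div p * card H" using H(2) p(2) by simp
      fix h assume h: "h \<in> H" "h \<noteq> \<one>"
      have hc: "h \<in> carrier G" using h H(1) subgroup.subset by blast
      interpret H: group "G\<lparr>carrier := H\<rparr>" by (rule subgroup.subgroup_is_group[OF H(1) group_axioms])
      have "h [^]\<^bsub>G\<lparr>carrier := H\<rparr>\<^esub> order (G\<lparr>carrier := H\<rparr>) = \<one>\<^bsub>G\<lparr>carrier := H\<rparr>\<^esub>"
        by (rule H.pow_order_eq_1) (use h in simp)
      hence "h [^] p = \<one>" using H(2) by (simp add: Coset.order_def nat_pow_consistent[symmetric])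
      thus "character M h = 0"
        using character_vanishes_on_order_p[OF M p sq[OF p(1)] hc] h(2) by blast
    qed
  qed
  define m where "m = (LEAST m::nat. m > 0 \<and> regular_multiple M (int m))"
  have m: "m > 0" "regular_multiple M (int m)"
    using LeastI[of "\<lambda>m::nat. m > 0 \<and> regular_multiple M (int m)" "vdim M"] d d0 by (auto simp: m_def)
  have gen: "m dvd n" if n: "regular_multiple M (int n)" for n
  proof (rule ccontr)
    assume "\<not> m dvd n"
    hence pos: "n mod m > 0" by (simp add: mod_greater_zero_iff_not_dvd)
    have "int (n mod m) = int n + (- int (n div m)) * int m"
      by (simp add: zmod_int zdiv_int minus_div_mult_eq_mod[symmetric])
    hence "regular_multiple M (int (n mod m))"
      using regular_multiple_add[OF n regular_multiple_scale[OF m(2), of "- int (n div m)"]] by simp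
    hence "m \<le> n mod m" unfolding m_def using pos by (intro Least_le) (auto simp: m_def)
    thus False using m(1) mod_less_divisor[of m n] by linarith
  qed
  have "m = 1"
  proof (rule ccontr)
    assume "m \<noteq> 1"
    then obtain p where p: "prime p" "p dvd m" using prime_factor_nat by blast
    have "p dvd vdim M" using p(2) gen[OF d] dvd_trans by blast
    moreover from this have "p dvd vdim M div p" using p gen[OF dp] dvd_trans by blast
    ultimately have "p * p dvd vdim M" by (metis dvd_div_mult_self mult_dvd_mono dvd_refl)
    hence "p\<^sup>2 dvd order G" using degree_dvd_order[OF M] dvd_trans by (auto simp: power2_eq_square)
    thus False using sq[OF p(1)] by blast
  qed
  thus ?thesis using m by simp
qed

lemma knutson_index_one:
  assumes M: "gmod M" and one: "regular_multiple M 1"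
  shows "knutson_index G M = 1"
proof -
  obtain N where N: "virtual_module G N" and eq: "\<And>g. g \<in> carrier G \<Longrightarrow>
      character M g * virtual_character N g = character (regular_cg_module G) g"
    using one by (auto simp: regular_multiple_def)
  have gN: "gmod S" if "(a, S) \<in> set N" for a S
    using N that by (auto simp: virtual_module_def simple_cg_module_def)
  have vc: "virtual_character (virtual_tensor M N) g = character M g * virtual_character N g"
    if g: "g \<in> carrier G" for g
    using gN unfolding virtual_character_def virtual_tensor_def
  proof (induction N)
    case (Cons x N)
    obtain a S where [simp]: "x = (a, S)" by force
    have S: "gmod S" using Cons.prems[of a S] by simp
    have "(\<Sum>(a, S)\<leftarrow>map (\<lambda>(a, S). (a, cg_tensor M S)) N. of_int a * character S g) =
        character M g * (\<Sum>(a, S)\<leftarrow>N. of_int a * character S g)"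
      using Cons.prems by (intro Cons.IH) auto
    thus ?case by (simp add: tensor_module(2)[OF M S g] distrib_left)
  qed simp
  have "rep_ring_eq G (virtual_tensor M N) [(int 1, regular_cg_module G)]"
  proof (rule rep_ring_eqI)
    show "\<forall>(a, S)\<in>set (virtual_tensor M N). gmod S"
      using gN M by (auto simp: virtual_tensor_def intro!: tensor_module(1))
    show "virtual_character (virtual_tensor M N) g = virtual_character [(int 1, regular_cg_module G)] g"
      if "g \<in> carrier G" for g
      using vc[OF that] eq[OF that] by (simp add: virtual_character_def)
  qed (simp add: regular_module(1))
  thus ?thesis unfolding knutson_index_def using N by (intro Least_equality) auto
qed

end

theorem corollary2p19:
  fixes G (structure)
  assumes "group G"
    and "finite (carrier G)"
    and "\<exists>P :: nat set. finite P \<and> (\<forall>p\<in>P. prime p) \<and> order G = (\<Prod>p\<in>P. p)"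
  shows "group_algebra_of_knutson_type G"
proof -
  interpret fin_group G using assms(1,2) by (simp add: fin_group_def fin_group_axioms_def)
  obtain P :: "nat set" where P: "\<forall>p\<in>P. prime p" "order G = (\<Prod>p\<in>P. p)" using assms(3) by blast
  have "squarefree (order G)"
    unfolding P(2) using P(1) by (intro squarefree_prod_coprime) (auto intro: primes_coprime squarefree_prime)
  thus ?thesis
    unfolding group_algebra_of_knutson_type_def
    using knutson_index_one regular_multiple_one by (auto simp: simple_cg_module_def)
qed

end
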